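(* Let $l\in\mathbb N$ and let $\mathbb Q$ be a probability measure on $(C,\mathcal F)$ such that the canonical process $X$ is a square integrable martingale under $\mathbb Q$, $X_0=0$ $\mathbb Q$-a.s., and the quadratic covariation of $X$ is absolutely continuous under $\mathbb Q$, i.e. $d\langle X\rangle_t/dt=\Sigma_t^{\mathbb Q}$, where $\Sigma^{\mathbb Q}$ is a predictable process with values in the symmetric positive semidefinite $l\times l$ matrices. Then $$h_l(\mathbb Q|\mathbb B^l)\ \ge\ \mathbb E_{\mathbb Q}\left[\int_0^1 F_l(\Sigma_t^{\mathbb Q})\,dt\right].$$
   Context: $C:=C([0,1];\mathbb R^l)$ is the space of continuous paths $\omega:[0,1]\to\mathbb R^l$, $X_t(\omega)=\omega(t)$ is the canonical process, $\mathcal F_t=\sigma(X_s:s\le t)$, $\mathcal F=\mathcal F_1$. Martingales are with respect to $(\mathcal F_t)_{t\in[0,1]}$; square integrable means $\mathbb E_{\mathbb Q}[|X_1^i|^2]<\infty$ for $i=1,\dots,l$. $\langle X\rangle$ is the matrix-valued process with entries $\langle X^i,X^j\rangle$. $\mathbb B^l$ is the law of standard $\mathbb R^l$-valued Brownian motion (Wiener measure) started at $0$. Relative entropy: $H(\mu|\nu)=\int\log\frac{d\mu}{d\nu}\,d\mu$ if $\mu\ll\nu$, and $+\infty$ otherwise. For $n\in\mathbb N$, $\mathcal F^n:=\sigma(X_{k/n}:k=0,1,\dots,n)$ and $H(\mathbb Q|\mathbb P)|_{\mathcal F^n}$ is the relative entropy between the restrictions of $\mathbb Q$ and $\mathbb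 P$ to $\mathcal F^n$. For probability measures $\mathbb Q,\mathbb P$ under which $X$ is a martingale, the specific relative entropy is $$h_l(\mathbb Q|\mathbb P):=\liminf_{n\to\infty}2^{-n}H(\mathbb Q|\mathbb P)|_{\mathcal F^{2^n}}\in[0,\infty].$$ For a symmetric positive semidefinite $l\times l$ matrix $\Sigma$, $F_l(\Sigma):=\frac12\{\mathrm{tr}(\Sigma)-l-\log\det\Sigma\}$, with the convention $-\log 0=+\infty$; $F_l$ takes values in $[0,\infty]$. *)

theory Defs
  imports "HOL-Probability.Probability"
begin

section \<open>Path space and canonical filtration\<close>

text \<open>
  \<open>\<real>\<^sup>l\<close> is \<open>real ^ 'l\<close> with \<open>l = CARD('l)\<close>.  A path on \<open>[0,1]\<close> is represented by its unique
  extensional representative (value \<open>undefined\<close> outside \<open>{0..1}\<close>), so that paths which agree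
  on \<open>[0,1]\<close> are equal.  The canonical process is \<open>X\<^sub>t \<omega> = \<omega> t\<close>.
\<close>

definition paths :: "(real \<Rightarrow> real ^ 'l::finite) set" where
  "paths = {\<omega> \<in> extensional {0..1}. continuous_on {0..1} \<omega>}"

text \<open>\<open>\<sigma>(X\<^sub>s : s \<in> T)\<close>; as a measure space only its carrier and its measurable sets matter.\<close>

definition path_sigma :: "real set \<Rightarrow> (real \<Rightarrow> real ^ 'l::finite) measure" where
  "path_sigma T = sigma paths {{\<omega> \<in> paths. \<omega> s \<in> A} |s A. s \<in> T \<and> A \<in> sets borel}"

abbreviation path_filtration :: "real \<Rightarrow> (real \<Rightarrow> real ^ 'l::finite) measure" where
  "path_filtration t \<equiv> path_sigma {0..t}"

definition grid_sigma :: "nat \<Rightarrow> (real \<Rightarrow> real ^ 'l::finite) measure" where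
  "grid_sigma n = path_sigma {real k / real n |k. k \<le> n}"

definition is_path_law :: "(real \<Rightarrow> real ^ 'l::finite) measure \<Rightarrow> bool" where
  "is_path_law Q \<longleftrightarrow> prob_space Q \<and> sets Q = sets (path_filtration 1)"

definition predictable_sigma :: "(real \<times> (real \<Rightarrow> real ^ 'l::finite)) measure" where
  "predictable_sigma = sigma ({0..1} \<times> paths)
     ({{0} \<times> A |A. A \<in> sets (path_filtration 0)} \<union>
      {{s<..t} \<times> A |s t A. 0 \<le> s \<and> s < t \<and> t \<le> 1 \<and> A \<in> sets (path_filtration s)})"


section \<open>Martingales and quadratic covariation\<close>

definition is_martingale ::
    "(real \<Rightarrow> real ^ 'l::finite) measure \<Rightarrow> (real \<Rightarrow> (real \<Rightarrow> real ^ 'l) \<Rightarrow> real) \<Rightarrow> bool" where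
  "is_martingale Q M \<longleftrightarrow>
     (\<forall>t\<in>{0..1}. M t \<in> borel_measurable (path_filtration t) \<and> integrable Q (M t)) \<and>
     (\<forall>s t. 0 \<le> s \<and> s \<le> t \<and> t \<le> 1 \<longrightarrow>
        (AE \<omega> in Q. real_cond_exp Q (path_filtration s) (M t) \<omega> = M s \<omega>))"

definition canonical_square_integrable_martingale ::
    "(real \<Rightarrow> real ^ 'l::finite) measure \<Rightarrow> bool" where
  "canonical_square_integrable_martingale Q \<longleftrightarrow>
     (\<forall>i. is_martingale Q (\<lambda>t \<omega>. \<omega> t $ i) \<and> integrable Q (\<lambda>\<omega>. (\<omega> 1 $ i)\<^sup>2))"

definition finite_variation :: "(real \<Rightarrow> real) \<Rightarrow> bool" where
  "finite_variation f \<longleftrightarrow>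
     (\<exists>K. \<forall>n (p :: nat \<Rightarrow> real). mono p \<and> range p \<subseteq> {0..1} \<longrightarrow>
        (\<Sum>k<n. \<bar>f (p (Suc k)) - f (p k)\<bar>) \<le> K)"

text \<open>
  \<open>A\<close> is (a version of) \<open>\<langle>X\<^sup>i,X\<^sup>j\<rangle>\<close> under \<open>Q\<close>: the adapted process, almost surely null at \<open>0\<close>,
  continuous and of finite variation, for which \<open>X\<^sup>i X\<^sup>j - A\<close> is a martingale.  These properties
  determine \<open>A\<close> up to indistinguishability.  Path properties are only required almost surely,
  since the filtration is not completed.
\<close>

definition is_quadratic_covariation ::
    "(real \<Rightarrow> real ^ 'l::finite) measure \<Rightarrow> 'l \<Rightarrow> 'l \<Rightarrow>
     (real \<Rightarrow> (real \<Rightarrow> real ^ 'l) \<Rightarrow> real) \<Rightarrow> bool" where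
  "is_quadratic_covariation Q i j A \<longleftrightarrow>
     (\<forall>t\<in>{0..1}. A t \<in> borel_measurable (path_filtration t)) \<and>
     (AE \<omega> in Q. A 0 \<omega> = 0 \<and> continuous_on {0..1} (\<lambda>t. A t \<omega>) \<and> finite_variation (\<lambda>t. A t \<omega>)) \<and>
     is_martingale Q (\<lambda>t \<omega>. \<omega> t $ i * \<omega> t $ j - A t \<omega>)"


section \<open>Wiener measure\<close>

text \<open>Continuity of the Brownian paths is built into \<^const>\<open>paths\<close>.\<close>

definition is_wiener_measure :: "(real \<Rightarrow> real ^ 'l::finite) measure \<Rightarrow> bool" where
  "is_wiener_measure B \<longleftrightarrow>
     is_path_law B \<and>
     (AE \<omega> in B. \<omega> 0 = 0) \<and>
     (\<forall>s t. 0 \<le> s \<and> s < t \<and> t \<le> 1 \<longrightarrow>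
        distributed B lborel (\<lambda>\<omega>. \<omega> t - \<omega> s)
          (\<lambda>x. ennreal (\<Prod>i\<in>UNIV. normal_density 0 (sqrt (t - s)) (x $ i))) \<and>
        prob_space.indep_set B (sets (path_filtration s))
          {{\<omega> \<in> paths. \<omega> t - \<omega> s \<in> A} |A. A \<in> sets borel})"


section \<open>Relative entropy and specific relative entropy\<close>

text \<open>
  \<open>H(\<mu>|\<nu>)\<close>.  The negative part of \<open>log (d\<mu>/d\<nu>)\<close> is always \<open>\<mu>\<close>-integrable, so for \<open>\<mu> \<lless> \<nu>\<close> the
  integral is \<open>+\<infinity>\<close> exactly when \<open>log (d\<mu>/d\<nu>)\<close> is not \<open>\<mu>\<close>-integrable; \<^const>\<open>KL_divergence\<close>, being
  real-valued, would return \<open>0\<close> there.  Note the argument order: the reference measure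
  comes first in \<^const>\<open>absolutely_continuous\<close>, \<^const>\<open>entropy_density\<close> and \<^const>\<open>KL_divergence\<close>.
\<close>

definition relative_entropy :: "'a measure \<Rightarrow> 'a measure \<Rightarrow> ereal" where
  "relative_entropy \<mu> \<nu> =
     (if absolutely_continuous \<nu> \<mu> \<and> integrable \<mu> (entropy_density (exp 1) \<nu> \<mu>)
      then ereal (KL_divergence (exp 1) \<nu> \<mu>) else \<infinity>)"

definition specific_relative_entropy ::
    "(real \<Rightarrow> real ^ 'l::finite) measure \<Rightarrow> (real \<Rightarrow> real ^ 'l) measure \<Rightarrow> ereal" where
  "specific_relative_entropy Q P =
     liminf (\<lambda>n. ereal (1 / 2 ^ n) *
       relative_entropy (restr_to_subalg Q (grid_sigma (2 ^ n)))
                        (restr_to_subalg P (grid_sigma (2 ^ n))))"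


section \<open>The integrand\<close>

definition pos_semidef :: "real ^ 'l ^ 'l::finite \<Rightarrow> bool" where
  "pos_semidef S \<longleftrightarrow> transpose S = S \<and> (\<forall>x. 0 \<le> x \<bullet> (S *v x))"

definition neg_log :: "real \<Rightarrow> ereal" where
  "neg_log x = (if x = 0 then \<infinity> else ereal (- ln x))"

text \<open>Only used for positive semidefinite \<open>S\<close>, where the value is in \<open>[0,\<infinity>]\<close>.\<close>

definition F_fun :: "real ^ 'l ^ 'l::finite \<Rightarrow> ereal" where
  "F_fun S = ereal (1/2) * (ereal (trace S - real CARD('l)) + neg_log (det S))"

end

theory Submission
  imports Defs
begin

text \<open>
  The entropy on a dyadic grid is bounded from below by testing \<open>Q\<close> against Gaussian laws, and the
  tests are then optimised as the grid is refined.

  For invertible \<open>T\<close>, the log-likelihood ratio of the centred Gaussian law with covariance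
  \<open>(T\<^sup>t T)\<^sup>-\<^sup>1\<close> relative to the standard one is \<open>ln \<bar>det T\<bar> - (\<bar>T x\<bar>\<^sup>2 - \<bar>x\<bar>\<^sup>2) / 2\<close>.  Its mean depends on the
  law of \<open>x\<close> only through the second moments \<open>S\<close>; this mean is called \<open>gauss_gain T S\<close> below.  It is
  affine in \<open>S\<close>, and its supremum over \<open>T\<close> is \<open>F(S)\<close>: for invertible \<open>S\<close> the best Gaussian has covariance \<open>S\<close>.  By
  continuity in \<open>T\<close>, countably many \<open>T\<^sub>0 = 1, T\<^sub>1, T\<^sub>2, \<dots>\<close> suffice (\<open>F_fun_le_SUP_gauss_gain\<close>).

  On the grid of mesh \<open>2\<^sup>-\<^sup>n\<close>, let an index \<open>J\<close> be chosen for each time step as a function of the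
  path observed on the grid so far, and multiply the likelihood ratios of the rescaled increments
  for the chosen \<open>T\<^sub>J\<close>.  Under Wiener measure this product has mean \<open>1\<close>, step by step, because the next
  increment is Gaussian and independent of the past (\<open>wiener_measure_gauss_step\<close>).  Hence, by the
  variational inequality \<open>H(\<mu>|\<nu>) \<ge> \<integral> L d\<mu>\<close> if \<open>\<integral> exp L d\<nu> \<le> 1\<close> (\<open>KL_divergence_ge_integral\<close>), the entropy
  on the grid is at least the mean under \<open>Q\<close> of the logarithm of the product.  This logarithm is
  quadratic in the increments, so the martingale property replaces the products of increments by
  increments of \<open>\<langle>X\<rangle>\<close> (\<open>increment_product_integral\<close>), that is, by integrals of \<open>\<Sigma>\<close>.  The outcome is
  \<open>2\<^sup>-\<^sup>n H \<ge> E \<integral> gauss_gain T\<^sub>J \<Sigma>\<^sub>t dt\<close> for every grid-adapted selection \<open>J\<close> (\<open>relative_entropy_grid_ge\<close>).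
  No conditional law and no conditional covariance has to be computed.

  The selection that one would like to use picks, among \<open>T\<^sub>0, \<dots>, T\<^sub>r\<close>, the best one for \<open>\<Sigma>\<^sub>t\<close>.  It is
  predictable.  Since paths are continuous, the grid-adapted sets of all levels generate the
  predictable sets in positive time (\<open>predictable_generated_by_grid\<close>), so a grid-adapted selection
  agrees with it up to a set of small measure at every sufficiently fine level
  (\<open>grid_selection_near_best\<close>).  Thus \<open>h(Q|B) \<ge> E \<integral> max\<^bsub>i \<le> r\<^esub> gauss_gain T\<^sub>i \<Sigma>\<^sub>t dt\<close>.  The maximum is
  nonnegative because \<open>T\<^sub>0 = 1\<close> gains nothing, and it increases with \<open>r\<close> to \<open>F(\<Sigma>\<^sub>t)\<close>; monotone convergence
  finishes the proof.
\<close>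

section \<open>Linear change of variables for Lebesgue measure\<close>

text \<open>
  Only the coordinate \<open>m\<close> moves.  Integrating over it first, with the other coordinates fixed, the
  shear is a translation of the real line.
\<close>

lemma nn_integral_lborel_shear:
  fixes f :: "real ^ 'n::finite \<Rightarrow> ennreal"
  assumes [measurable]: "f \<in> borel_measurable borel" and mn: "m \<noteq> n"
  shows "(\<integral>\<^sup>+x. f (x + (x $ n) *\<^sub>R axis m 1) \<partial>lborel) = (\<integral>\<^sup>+x. f x \<partial>lborel)"
proof -
  interpret product_sigma_finite "\<lambda>_::real ^ 'n. lborel :: real measure" ..
  define e :: "real ^ 'n" where "e = axis m 1"
  define R :: "(real ^ 'n) set" where "R = Basis - {e}"
  have eB: "e \<in> Basis" by (simp add: e_def axis_in_Basis_iff)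
  then have Basis: "Basis = insert e R" "e \<notin> R" "finite R" by (auto simp: R_def)
  have nR: "axis n 1 \<in> R"
    using mn by (auto simp: R_def e_def axis_in_Basis_iff axis_eq_axis)
  let ?s = "\<lambda>g :: real ^ 'n \<Rightarrow> real. \<Sum>b\<in>Basis. g b *\<^sub>R b"
  have s_nth: "?s g $ n = g (axis n 1)" for g
  proof -
    have "?s g $ n = ?s g \<bullet> axis n 1" by (simp add: inner_axis)
    also have "\<dots> = g (axis n 1)"
      by (rule inner_sum_left_Basis) (simp add: axis_in_Basis_iff)
    finally show ?thesis .
  qed
  have upd: "?s (g(e := y)) = y *\<^sub>R e + (\<Sum>b\<in>R. g b *\<^sub>R b)" for g y
    unfolding Basis(1) using Basis(2,3) by (auto intro!: sum.cong)
  \<comment> \<open>The case \<open>c = 1\<close> is the sheared integral and \<open>c = 0\<close> the original one.\<close>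
  have main: "(\<integral>\<^sup>+x. h (x + (x $ n) *\<^sub>R (c *\<^sub>R e)) \<partial>lborel) =
      (\<integral>\<^sup>+g. \<integral>\<^sup>+y. h ((c * g (axis n 1) + y) *\<^sub>R e + (\<Sum>b\<in>R. g b *\<^sub>R b)) \<partial>lborel \<partial>(\<Pi>\<^sub>M b\<in>R. lborel))"
    if [measurable]: "h \<in> borel_measurable borel" for h :: "real ^ 'n \<Rightarrow> ennreal" and c
  proof -
    have "(\<integral>\<^sup>+x. h (x + (x $ n) *\<^sub>R (c *\<^sub>R e)) \<partial>lborel)
        = (\<integral>\<^sup>+g. h (?s g + (g (axis n 1)) *\<^sub>R (c *\<^sub>R e)) \<partial>(\<Pi>\<^sub>M b\<in>Basis. lborel))"
      by (subst lborel_eq, subst nn_integral_distr) (simp_all add: s_nth del: sum_component)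
    also have "\<dots> = (\<integral>\<^sup>+g. \<integral>\<^sup>+y. h (?s (g(e := y)) + ((g(e := y)) (axis n 1)) *\<^sub>R (c *\<^sub>R e)) \<partial>lborel \<partial>(\<Pi>\<^sub>M b\<in>R. lborel))"
      using nR unfolding Basis(1) by (subst product_nn_integral_insert) (use Basis in simp_all)
    also have "\<dots> = (\<integral>\<^sup>+g. \<integral>\<^sup>+y. h ((c * g (axis n 1) + y) *\<^sub>R e + (\<Sum>b\<in>R. g b *\<^sub>R b)) \<partial>lborel \<partial>(\<Pi>\<^sub>M b\<in>R. lborel))"
    proof -
      have "e \<noteq> axis n 1" using nR Basis by auto
      then show ?thesis unfolding upd
        by (intro nn_integral_cong arg_cong[where f=h]) (simp add: algebra_simps)
    qed
    finally show ?thesis .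
  qed
  have tr: "(\<integral>\<^sup>+y. f ((a + y) *\<^sub>R e + z) \<partial>lborel) = (\<integral>\<^sup>+y. f (y *\<^sub>R e + z) \<partial>lborel)" for a z
    by (subst (2) lborel_distr_plus[of a, symmetric]) (simp add: nn_integral_distr)
  show ?thesis using main[of f 1] main[of f 0] unfolding e_def[symmetric]
    by (simp add: tr)
qed

text \<open>
  Linear change of variables over an arbitrary finite index type.  The formula is preserved by
  composition, so it is enough to check it on generators of the linear maps; singular maps are
  excluded by the determinant condition.
\<close>

lemma nn_integral_lborel_linear:
  fixes g :: "real ^ 'n::finite \<Rightarrow> real ^ 'n"
  assumes "linear g" "det (matrix g) \<noteq> 0" "f \<in> borel_measurable borel"
  shows "(\<integral>\<^sup>+x. ennreal \<bar>det (matrix g)\<bar> * f (g x) \<partial>lborel) = (\<integral>\<^sup>+x. f x \<partial>lborel)"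
proof -
  define P where "P g \<longleftrightarrow> (det (matrix g) \<noteq> 0 \<longrightarrow> (\<forall>f\<in>borel_measurable borel.
     (\<integral>\<^sup>+x. ennreal \<bar>det (matrix g)\<bar> * f (g x) \<partial>lborel) = (\<integral>\<^sup>+x. f x \<partial>lborel)))"
    for g :: "real ^ 'n \<Rightarrow> real ^ 'n"
  have lin_meas: "g \<in> borel_measurable borel" if "linear g" for g :: "real ^ 'n \<Rightarrow> real ^ 'n"
    using that by (intro borel_measurable_continuous_onI linear_continuous_on linear_conv_bounded_linear[THEN iffD1])
  have comp: "P (g \<circ> h)" if "linear g" "linear h" "P g" "P h" for g h
    unfolding P_def
  proof (intro impI ballI)
    fix f :: "real ^ 'n \<Rightarrow> ennreal" assume f[measurable]: "f \<in> borel_measurable borel"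
    have [measurable]: "g \<in> borel_measurable borel" "h \<in> borel_measurable borel"
      using lin_meas that by auto
    have mc: "matrix (g \<circ> h) = matrix g ** matrix h"
      using matrix_compose that by blast
    assume "det (matrix (g \<circ> h)) \<noteq> 0"
    then have nz: "det (matrix g) \<noteq> 0" "det (matrix h) \<noteq> 0" by (auto simp: mc det_mul)
    have "(\<integral>\<^sup>+x. ennreal \<bar>det (matrix (g \<circ> h))\<bar> * f ((g \<circ> h) x) \<partial>lborel)
      = (\<integral>\<^sup>+x. ennreal \<bar>det (matrix h)\<bar> * (ennreal \<bar>det (matrix g)\<bar> * f (g (h x))) \<partial>lborel)"
      by (simp add: mc det_mul abs_mult ennreal_mult mult_ac)
    also have "\<dots> = (\<integral>\<^sup>+x. ennreal \<bar>det (matrix g)\<bar> * f (g x) \<partial>lborel)"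
      using that(4)[unfolded P_def, rule_format, OF nz(2), of "\<lambda>x. ennreal \<bar>det (matrix g)\<bar> * f (g x)"] by simp
    also have "\<dots> = (\<integral>\<^sup>+x. f x \<partial>lborel)"
      using that(3)[unfolded P_def, rule_format, OF nz(1) f] .
    finally show "(\<integral>\<^sup>+x. ennreal \<bar>det (matrix (g \<circ> h))\<bar> * f ((g \<circ> h) x) \<partial>lborel) = (\<integral>\<^sup>+x. f x \<partial>lborel)" .
  qed
  have stretch: "P (\<lambda>x. \<chi> i. c i * x $ i)" for c
    unfolding P_def
  proof (intro impI ballI)
    fix f :: "real ^ 'n \<Rightarrow> ennreal" assume f[measurable]: "f \<in> borel_measurable borel"
    let ?g = "\<lambda>x::real ^ 'n. \<chi> i. c i * x $ i"
    have d: "det (matrix ?g) = prod c UNIV"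
      by (subst det_diagonal) (auto simp: matrix_def axis_def intro!: prod.cong)
    assume "det (matrix ?g) \<noteq> 0"
    then have c0: "c i \<noteq> 0" for i by (auto simp: d)
    define C where "C b = (\<Sum>i\<in>UNIV. b $ i * c i)" for b :: "real ^ 'n"
    have C: "C (axis i 1) = c i" for i
      by (simp add: C_def axis_def if_distrib[of "\<lambda>x. x * _"] cong: if_cong)
    have B: "(Basis :: (real ^ 'n) set) = (\<lambda>i. axis i 1) ` UNIV" by (auto simp: Basis_vec_def)
    have inj: "inj (\<lambda>i. axis i (1::real) :: real ^ 'n)" by (auto simp: inj_def axis_eq_axis)
    have T: "0 + (\<Sum>j\<in>Basis. (C j * (x \<bullet> j)) *\<^sub>R j) = ?g x" for x
      unfolding B by (subst sum.reindex[OF inj])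
        (simp add: C inner_axis vec_eq_iff, simp add: axis_def if_distrib[of "\<lambda>x. _ * x"] cong: if_cong)
    have pr: "(\<Prod>j\<in>(Basis::(real ^ 'n) set). \<bar>C j\<bar>) = \<bar>det (matrix ?g)\<bar>"
      unfolding B d by (subst prod.reindex[OF inj]) (simp add: C abs_prod)
    have [measurable]: "?g \<in> borel_measurable borel"
      by (intro lin_meas linearI) (auto simp: vec_eq_iff algebra_simps)
    have "lborel = density (distr lborel borel ?g) (\<lambda>_. ennreal \<bar>det (matrix ?g)\<bar>)"
      by (rule lborel_affine_euclidean[of C 0, unfolded T pr]) (use c0 C in \<open>auto simp: B\<close>)
    then have "(\<integral>\<^sup>+x. f x \<partial>lborel) = (\<integral>\<^sup>+x. f x \<partial>density (distr lborel borel ?g) (\<lambda>_. ennreal \<bar>det (matrix ?g)\<bar>))"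
      by metis
    then show "(\<integral>\<^sup>+x. ennreal \<bar>det (matrix ?g)\<bar> * f (?g x) \<partial>lborel) = (\<integral>\<^sup>+x. f x \<partial>lborel)"
      by (simp add: nn_integral_density nn_integral_distr)
  qed
  have shear: "P (\<lambda>x. \<chi> i. if i = m then x $ m + x $ n else x $ i)" if "m \<noteq> n" for m n
    unfolding P_def
  proof (intro impI ballI)
    fix f :: "real ^ 'n \<Rightarrow> ennreal" assume f[measurable]: "f \<in> borel_measurable borel"
    let ?g = "\<lambda>x::real ^ 'n. \<chi> i. if i = m then x $ m + x $ n else x $ i"
    have "matrix ?g = (\<chi> k. if k = m then row m (mat 1) + 1 *s row n (mat 1) else row k (mat 1))"
      by (auto simp: matrix_def vec_eq_iff row_def mat_def axis_def)
    then have d: "det (matrix ?g) = 1"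
      using det_row_operation[OF that, where c=1 and A="mat 1 :: real ^ 'n ^ 'n"] by simp
    have "?g x = x + (x $ n) *\<^sub>R axis m 1" for x
      by (auto simp: vec_eq_iff axis_def)
    then show "(\<integral>\<^sup>+x. ennreal \<bar>det (matrix ?g)\<bar> * f (?g x) \<partial>lborel) = (\<integral>\<^sup>+x. f x \<partial>lborel)"
      using nn_integral_lborel_shear[OF f that] d by simp
  qed
  have lin_stretch: "linear (\<lambda>x::real ^ 'n. \<chi> i. c i * x $ i)" for c
    by (intro linearI) (auto simp: vec_eq_iff algebra_simps)
  have lin_shear: "linear (\<lambda>x::real ^ 'n. \<chi> i. if i = m then x $ m + x $ n else x $ i)" for m n
    by (intro linearI) (auto simp: vec_eq_iff algebra_simps)
  have swap: "P (\<lambda>x. \<chi> i. x $ Transposition.transpose m n i)" if mn: "m \<noteq> n" for m n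
  proof -
    \<comment> \<open>A transposition is a product of three shears and three sign changes: \<open>(a,b) \<rightarrow> (a+b,b) \<rightarrow> (a+b,-b) \<rightarrow> (a+b,a) \<rightarrow> (a+b,-a) \<rightarrow> (b,-a) \<rightarrow> (b,a)\<close>.\<close>
    let ?N = "\<lambda>x::real ^ 'n. \<chi> i. (if i = n then -1 else 1) * x $ i"
    let ?A = "\<lambda>x::real ^ 'n. \<chi> i. if i = m then x $ m + x $ n else x $ i"
    let ?B = "\<lambda>x::real ^ 'n. \<chi> i. if i = n then x $ n + x $ m else x $ i"
    have "(\<lambda>x::real ^ 'n. \<chi> i. x $ Transposition.transpose m n i) = ?N \<circ> (?A \<circ> (?N \<circ> (?B \<circ> (?N \<circ> ?A))))"
      using mn by (auto simp: fun_eq_iff vec_eq_iff Transposition.transpose_def)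
    then show ?thesis
      using mn by (simp only:) (intro comp linear_compose lin_stretch lin_shear stretch shear; simp)
  qed
  have zero: "P g" if "linear g" "\<And>x. g x $ i = 0" for g i
  proof -
    have "row i (matrix g) = 0" using that by (auto simp: row_def matrix_def vec_eq_iff)
    then show ?thesis by (simp add: P_def det_zero_row)
  qed
  have "P g"
    by (rule induct_linear_elementary[OF assms(1), of P, OF comp zero stretch swap shear])
  then show ?thesis using assms by (auto simp: P_def)
qed

section \<open>Gaussian test matrices and the function F\<close>

text \<open>
  The mean of \<open>ln \<bar>det T\<bar> - (\<bar>T x\<bar>\<^sup>2 - \<bar>x\<bar>\<^sup>2) / 2\<close> when \<open>x\<close> has second moments \<open>S\<close>; the function inside is the
  logarithm of the density of the Gaussian law with covariance \<open>(T\<^sup>t T)\<^sup>-\<^sup>1\<close> relative to the standard one.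
  Parametrising by \<open>T\<close> instead of by the covariance avoids square roots of matrices.
\<close>

definition gauss_gain :: "real ^ 'n ^ 'n::finite \<Rightarrow> real ^ 'n ^ 'n \<Rightarrow> real" where
  "gauss_gain T S = ln \<bar>det T\<bar>
     - 1/2 * (\<Sum>a\<in>UNIV. \<Sum>b\<in>UNIV. ((transpose T ** T) $ a $ b - mat 1 $ a $ b) * S $ a $ b)"

lemma inner_matrix_symmetric:
  fixes S :: "real ^ 'n ^ 'n::finite"
  assumes "transpose S = S"
  shows "x \<bullet> (S *v y) = y \<bullet> (S *v x)"
  using assms by (metis dot_lmul_matrix inner_commute transpose_matrix_vector)

text \<open>
  Gram-Schmidt for the inner product given by \<open>S\<close>, one index at a time: the vectors \<open>S v\<^sub>i\<close> already present
  span a proper subspace, and any vector orthogonal to it can be normalised and added.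
\<close>

lemma exists_orthonormal_family:
  fixes S :: "real ^ 'n ^ 'n::finite"
  assumes sym: "transpose S = S" and pos: "\<And>x. x \<noteq> 0 \<Longrightarrow> 0 < x \<bullet> (S *v x)"
  shows "\<exists>v :: 'n \<Rightarrow> real ^ 'n. \<forall>i\<in>J. \<forall>j\<in>J. v i \<bullet> (S *v v j) = (if i = j then 1 else 0)"
  using finite[of J]
proof (induction J rule: finite_induct)
  case empty
  then show ?case by simp
next
  case (insert k J)
  then obtain v where v: "\<And>i j. i \<in> J \<Longrightarrow> j \<in> J \<Longrightarrow> v i \<bullet> (S *v v j) = (if i = j then 1 else 0)"
    by blast
  let ?V = "(\<lambda>i. S *v v i) ` J"
  have "dim ?V \<le> card J"
    using dim_le_card'[of ?V] card_image_le[of J "\<lambda>i. S *v v i"] by (auto intro: order_trans)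
  also have "\<dots> < card (UNIV :: 'n set)"
    using insert.hyps by (intro psubset_card_mono) auto
  finally have "dim ?V < DIM(real ^ 'n)" by simp
  then obtain x where x: "x \<noteq> 0" "\<And>y. y \<in> span ?V \<Longrightarrow> orthogonal x y"
    using orthogonal_to_subspace_exists by blast
  have x0: "x \<bullet> (S *v v i) = 0" if "i \<in> J" for i
    using x(2)[OF span_base] that by (auto simp: orthogonal_def)
  define c where "c = x \<bullet> (S *v x)"
  have c: "c > 0" using pos x by (simp add: c_def)
  define w where "w = v(k := (1 / sqrt c) *\<^sub>R x)"
  have "w i \<bullet> (S *v w j) = (if i = j then 1 else 0)" if "i \<in> insert k J" "j \<in> insert k J" for i j
  proof -
    have "v i \<bullet> (S *v x) = 0" if "i \<in> J" for i
      using x0[OF that] inner_matrix_symmetric[OF sym, of x "v i"] by simp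
    moreover have "(1 / sqrt c) * ((1 / sqrt c) * (x \<bullet> (S *v x))) = 1"
      using c by (simp add: c_def[symmetric] real_sqrt_mult_self field_simps)
    ultimately show ?thesis
      using that insert.hyps v x0
      by (cases "i = k"; cases "j = k") (auto simp: w_def matrix_vector_mult_scaleR)
  qed
  then show ?case by blast
qed

text \<open>
  Take an \<open>S\<close>-orthonormal basis as the rows of \<open>T\<close>.
\<close>

lemma exists_whitening_matrix:
  fixes S :: "real ^ 'n ^ 'n::finite"
  assumes sym: "transpose S = S" and pos: "\<And>x. x \<noteq> 0 \<Longrightarrow> 0 < x \<bullet> (S *v x)"
  shows "\<exists>T :: real ^ 'n ^ 'n. T ** S ** transpose T = mat 1"
proof -
  obtain v :: "'n \<Rightarrow> real ^ 'n" where v: "v i \<bullet> (S *v v j) = (if i = j then 1 else 0)" for i j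
    using exists_orthonormal_family[OF assms, of UNIV] by blast
  have "((\<chi> i. v i) ** S ** transpose (\<chi> i. v i)) $ i $ j = v i \<bullet> (S *v v j)" for i j
    by (subst matrix_mul_assoc[symmetric])
      (simp add: matrix_matrix_mult_def inner_vec_def matrix_vector_mult_def transpose_def)
  then show ?thesis by (intro exI[of _ "\<chi> i. v i"]) (simp add: v vec_eq_iff mat_def)
qed

text \<open>
  The Gaussian law with covariance \<open>S + e\<close> is a nearly optimal test for \<open>S\<close>.  Its gain would be
  \<open>F(S)\<close> for \<open>e = 0\<close>; the regularisation keeps it meaningful for singular \<open>S\<close> and enters the bound only
  through the determinant, because \<open>tr(T S T\<^sup>t) = l - e tr(T T\<^sup>t) \<le> l\<close>.
\<close>

lemma gauss_gain_whitening:
  fixes S T :: "real ^ 'n ^ 'n::finite"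
  assumes T: "T ** (S + e *\<^sub>R mat 1) ** transpose T = mat 1" and e: "0 \<le> e"
  shows "det T \<noteq> 0" "0 < det (S + e *\<^sub>R mat 1)"
    "(trace S - real CARD('n) - ln (det (S + e *\<^sub>R mat 1))) / 2 \<le> gauss_gain T S"
proof -
  let ?d = "det (S + e *\<^sub>R mat 1)"
  have "det (T ** (S + e *\<^sub>R mat 1) ** transpose T) = 1" using T by simp
  then have d: "(det T)\<^sup>2 * ?d = 1" by (simp add: det_mul power2_eq_square mult_ac)
  then show nz: "det T \<noteq> 0" by auto
  have "0 < (det T)\<^sup>2 * ?d" using d by simp
  then show pos: "0 < ?d" using nz by (simp add: zero_less_mult_iff)
  have "ln ((det T)\<^sup>2 * ?d) = 2 * ln \<bar>det T\<bar> + ln ?d"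
    using nz pos ln_realpow[of "\<bar>det T\<bar>" 2] by (simp add: ln_mult_pos)
  then have ln: "ln \<bar>det T\<bar> = - ln ?d / 2" using d by simp
  have tr: "(\<Sum>a\<in>UNIV. \<Sum>b\<in>UNIV. (transpose T ** T) $ a $ b * M $ a $ b) = trace (T ** M ** transpose T)"
    for M :: "real ^ 'n ^ 'n"
  proof -
    have "trace (T ** M ** transpose T) = (\<Sum>i\<in>UNIV. \<Sum>b\<in>UNIV. \<Sum>a\<in>UNIV. T $ i $ a * M $ a $ b * T $ i $ b)"
      by (simp add: trace_def matrix_matrix_mult_def transpose_def sum_distrib_right)
    also have "\<dots> = (\<Sum>b\<in>UNIV. \<Sum>i\<in>UNIV. \<Sum>a\<in>UNIV. T $ i $ a * M $ a $ b * T $ i $ b)"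
      by (rule sum.swap)
    also have "\<dots> = (\<Sum>b\<in>UNIV. \<Sum>a\<in>UNIV. \<Sum>i\<in>UNIV. T $ i $ a * M $ a $ b * T $ i $ b)"
      by (intro sum.cong refl sum.swap)
    also have "\<dots> = (\<Sum>a\<in>UNIV. \<Sum>b\<in>UNIV. \<Sum>i\<in>UNIV. T $ i $ a * M $ a $ b * T $ i $ b)"
      by (rule sum.swap)
    also have "\<dots> = (\<Sum>a\<in>UNIV. \<Sum>b\<in>UNIV. (transpose T ** T) $ a $ b * M $ a $ b)"
      unfolding matrix_matrix_mult_def transpose_def vec_lambda_beta sum_distrib_right
      by (intro sum.cong refl) (simp add: mult_ac)
    finally show ?thesis by simp
  qed
  have id: "(\<Sum>a\<in>UNIV. \<Sum>b\<in>UNIV. mat 1 $ a $ b * M $ a $ b) = trace M" for M :: "real ^ 'n ^ 'n"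
    by (simp add: mat_def trace_def if_distrib[of "\<lambda>x. x * _"] cong: if_cong)
  have "T ** (S + e *\<^sub>R mat 1) ** transpose T = T ** S ** transpose T + e *\<^sub>R (T ** transpose T)"
  proof -
    have "T ** (e *\<^sub>R mat 1) = e *\<^sub>R T"
      by (simp add: matrix_matrix_mult_def mat_def vec_eq_iff if_distrib[of "\<lambda>x. _ * x"] mult.commute cong: if_cong)
    then show ?thesis
      by (simp add: matrix_add_ldistrib)
        (simp add: matrix_matrix_mult_def vec_eq_iff sum.distrib sum_distrib_left distrib_right mult.assoc)
  qed
  then have "trace (T ** S ** transpose T) + e * trace (T ** transpose T) = real CARD('n)"
    using T trace_I[where 'n='n and 'a=real] by (simp add: trace_def sum.distrib sum_distrib_left)
  moreover have "0 \<le> trace (T ** transpose T)"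
    by (simp add: trace_def matrix_matrix_mult_def transpose_def sum_nonneg)
  ultimately have "trace (T ** S ** transpose T) \<le> real CARD('n)"
    using e by (smt (verit) mult_nonneg_nonneg)
  moreover have "gauss_gain T S = - ln ?d / 2 - 1/2 * (trace (T ** S ** transpose T) - trace S)"
    unfolding gauss_gain_def ln by (simp add: left_diff_distrib sum_subtractf tr id)
  ultimately show "(trace S - real CARD('n) - ln ?d) / 2 \<le> gauss_gain T S"
    by (simp add: field_simps)
qed

lemma tendsto_det:
  fixes f :: "_ \<Rightarrow> real ^ 'n ^ 'n::finite"
  assumes "(f \<longlongrightarrow> A) F"
  shows "((\<lambda>x. det (f x)) \<longlongrightarrow> det A) F"
  unfolding det_def by (intro tendsto_intros assms)

lemma tendsto_gauss_gain:
  fixes f :: "_ \<Rightarrow> real ^ 'n ^ 'n::finite"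
  assumes "(f \<longlongrightarrow> T) F" "det T \<noteq> 0"
  shows "((\<lambda>x. gauss_gain (f x) S) \<longlongrightarrow> gauss_gain T S) F"
  unfolding gauss_gain_def matrix_matrix_mult_def transpose_def vec_lambda_beta
  using assms by (intro tendsto_intros tendsto_det assms) auto

text \<open>
  The sequence enumerates a countable dense set of invertible matrices, with the identity in front so
  that the best of the first few gains is never negative.  Letting \<open>e\<close> tend to \<open>0\<close> in the regularised bound
  gives \<open>F\<close>, including the value \<open>\<infinity>\<close> at singular matrices.
\<close>

lemma F_fun_le_SUP_gauss_gain:
  "\<exists>T :: nat \<Rightarrow> real ^ 'n ^ 'n::finite. T 0 = mat 1 \<and> (\<forall>i. det (T i) \<noteq> 0) \<and>
     (\<forall>S. pos_semidef S \<longrightarrow> e2ennreal (F_fun S) \<le> (SUP i. ennreal (gauss_gain (T i) S)))"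
proof -
  obtain D :: "(real ^ 'n ^ 'n) set" where D: "countable D" "D \<subseteq> {T. det T \<noteq> 0}" "{T. det T \<noteq> 0} \<subseteq> closure D"
    using separable by blast
  have "mat 1 \<in> closure D" using D(3) by auto
  then have ne: "D \<noteq> {}" by auto
  define T where "T i = (case i of 0 \<Rightarrow> mat 1 | Suc j \<Rightarrow> from_nat_into D j)" for i
  have nz: "det (T i) \<noteq> 0" for i
    using from_nat_into[OF ne] D(2) by (auto simp: T_def split: nat.split)
  have D_T: "D \<subseteq> range T"
  proof
    fix x assume "x \<in> D"
    then obtain j where "x = from_nat_into D j" using D(1) by (metis from_nat_into_surj)
    then have "x = T (Suc j)" by (simp add: T_def)
    then show "x \<in> range T" by blast
  qed
  have sup: "ennreal (gauss_gain A S) \<le> (SUP i. ennreal (gauss_gain (T i) S))" if A: "det A \<noteq> 0" for A S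
  proof -
    obtain x where x: "\<And>n. x n \<in> D" "x \<longlonglongrightarrow> A"
      using D(3) A unfolding closure_sequential subset_iff by blast
    have "(\<lambda>n. ennreal (gauss_gain (x n) S)) \<longlonglongrightarrow> ennreal (gauss_gain A S)"
      by (intro tendsto_ennrealI tendsto_gauss_gain x A)
    moreover have "ennreal (gauss_gain (x n) S) \<le> (SUP i. ennreal (gauss_gain (T i) S))" for n
    proof -
      obtain i where "x n = T i" using x(1)[of n] D_T by blast
      then show ?thesis by (metis SUP_upper UNIV_I)
    qed
    ultimately show ?thesis by (intro LIMSEQ_le_const2) auto
  qed
  have "e2ennreal (F_fun S) \<le> (SUP i. ennreal (gauss_gain (T i) S))" (is "_ \<le> ?R") if S: "pos_semidef S" for S
  proof -
    define e where "e n = 1 / real (Suc n)" for n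
    have e: "0 < e n" for n by (simp add: e_def)
    have e0: "e \<longlonglongrightarrow> 0" unfolding e_def by (rule LIMSEQ_Suc[OF lim_1_over_n])
    define d where "d n = det (S + e n *\<^sub>R mat 1)" for n
    have ex: "\<exists>A :: real ^ 'n ^ 'n. A ** (S + e n *\<^sub>R mat 1) ** transpose A = mat 1" for n
    proof (rule exists_whitening_matrix)
      show "transpose (S + e n *\<^sub>R mat 1) = S + e n *\<^sub>R mat 1"
        using S by (auto simp: pos_semidef_def transpose_def mat_def vec_eq_iff)
      show "0 < x \<bullet> ((S + e n *\<^sub>R mat 1) *v x)" if "x \<noteq> 0" for x
      proof -
        have "x \<bullet> ((S + e n *\<^sub>R mat 1) *v x) = x \<bullet> (S *v x) + e n * (x \<bullet> x)"
          by (simp add: matrix_vector_mult_add_rdistrib scaleR_matrix_vector_assoc[symmetric] inner_add_right)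
        then show ?thesis using S that e by (simp add: pos_semidef_def add_nonneg_pos)
      qed
    qed
    have dpos: "0 < d n" and ge: "ennreal ((trace S - real CARD('n) - ln (d n)) / 2) \<le> ?R" for n
    proof -
      obtain A :: "real ^ 'n ^ 'n" where A: "A ** (S + e n *\<^sub>R mat 1) ** transpose A = mat 1" using ex by blast
      note w = gauss_gain_whitening[OF A less_imp_le[OF e]]
      show "0 < d n" using w by (simp add: d_def)
      show "ennreal ((trace S - real CARD('n) - ln (d n)) / 2) \<le> ?R"
        using w(3) sup[OF w(1), of S] unfolding d_def by (meson ennreal_leI order_trans)
    qed
    have "(\<lambda>n. S + e n *\<^sub>R mat 1) \<longlonglongrightarrow> S + 0 *\<^sub>R mat 1" by (intro tendsto_intros e0)
    then have dlim: "d \<longlonglongrightarrow> det S" unfolding d_def by (intro tendsto_det) simp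
    have "0 \<le> det S" using dpos by (intro LIMSEQ_le_const[OF dlim]) (auto intro: less_imp_le)
    then consider "det S = 0" | "0 < det S" by linarith
    then show ?thesis
    proof cases
      case 1
      have "filterlim (\<lambda>n. ln (d n)) at_bot sequentially"
        using dlim dpos 1 by (intro filterlim_compose[OF ln_at_0] tendsto_imp_filterlim_at_right) auto
      then have "filterlim (\<lambda>n. (trace S - real CARD('n)) / 2 + - ln (d n) * (1/2)) at_top sequentially"
        by (intro filterlim_tendsto_add_at_top[OF tendsto_const] filterlim_at_top_mult_tendsto_pos[OF tendsto_const]
             filterlim_uminus_at_bot[THEN iffD1]) auto
      then have lim: "filterlim (\<lambda>n. (trace S - real CARD('n) - ln (d n)) / 2) at_top sequentially"
        by (simp add: diff_divide_distrib)
      have "?R = \<infinity>"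
      proof (rule ccontr)
        assume "?R \<noteq> \<infinity>"
        then obtain r where r: "?R = ennreal r" "0 \<le> r" by (cases ?R) auto
        obtain n where "(trace S - real CARD('n) - ln (d n)) / 2 > r"
          using lim by (auto simp: filterlim_at_top_dense eventually_sequentially)
        with ge[of n] r show False by (simp add: ennreal_le_iff2)
      qed
      then show ?thesis by (simp only: infinity_ennreal_def top_greatest)
    next
      case 2
      then have "F_fun S = ereal ((trace S - real CARD('n) - ln (det S)) / 2)"
        by (simp add: F_fun_def neg_log_def)
      moreover have "(\<lambda>n. ennreal ((trace S - real CARD('n) - ln (d n)) / 2)) \<longlonglongrightarrow>
          ennreal ((trace S - real CARD('n) - ln (det S)) / 2)"
        using 2 dlim by (intro tendsto_intros tendsto_ennrealI) auto
      ultimately show ?thesis using ge by (auto intro!: LIMSEQ_le_const2 simp: e2ennreal_ereal)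
    qed
  qed
  then show ?thesis using nz by (intro exI[of _ T]) (auto simp: T_def)
qed

section \<open>The variational lower bound for relative entropy\<close>

text \<open>
  With \<open>D = dQ/dP\<close>, the bound \<open>ln y \<le> y - 1\<close> at \<open>y = exp L / D\<close> gives
  \<open>\<integral> (L - ln D) dQ \<le> \<integral> exp L / D dQ - 1 \<le> \<integral> exp L dP - 1 \<le> 0\<close>.
\<close>

lemma KL_divergence_ge_integral:
  assumes P: "prob_space P" and Q: "prob_space Q" and [measurable_cong]: "sets Q = sets P"
    and ac: "absolutely_continuous P Q"
    and int: "integrable Q (entropy_density (exp 1) P Q)"
    and L[measurable]: "L \<in> borel_measurable P" and Lint: "integrable Q L"
    and le1: "(\<integral>\<^sup>+x. ennreal (exp (L x)) \<partial>P) \<le> 1"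
  shows "(\<integral>x. L x \<partial>Q) \<le> KL_divergence (exp 1) P Q"
proof -
  interpret P: prob_space P by fact
  interpret Q: prob_space Q by fact
  obtain D where D[measurable]: "D \<in> borel_measurable P"
    and RN: "AE x in P. RN_deriv P Q x = ennreal (D x)"
    and Dpos: "AE x in Q. 0 < D x" and Dnn: "\<And>x. 0 \<le> D x"
    using P.real_RN_deriv[OF Q.finite_measure_axioms ac \<open>sets Q = sets P\<close>] by blast
  have RNQ: "AE x in Q. RN_deriv P Q x = ennreal (D x)"
    by (rule absolutely_continuous_AE[OF _ ac RN]) fact
  have Qd: "Q = density P (RN_deriv P Q)"
    using P.density_RN_deriv[OF ac \<open>sets Q = sets P\<close>] by simp
  define g where "g x = exp (L x) / D x" for x
  have [measurable]: "g \<in> borel_measurable P" unfolding g_def by measurable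
  have gnn: "0 \<le> g x" for x using Dnn by (simp add: g_def)
  have "(\<integral>\<^sup>+x. ennreal (g x) \<partial>Q) = (\<integral>\<^sup>+x. RN_deriv P Q x * ennreal (g x) \<partial>P)"
    by (subst Qd, subst nn_integral_density) auto
  also have "\<dots> \<le> (\<integral>\<^sup>+x. ennreal (exp (L x)) \<partial>P)"
  proof (rule nn_integral_mono_AE)
    show "AE x in P. RN_deriv P Q x * ennreal (g x) \<le> ennreal (exp (L x))"
      using RN by eventually_elim (use Dnn gnn in \<open>auto simp: g_def simp flip: ennreal_mult\<close>)
  qed
  finally have g1: "(\<integral>\<^sup>+x. ennreal (g x) \<partial>Q) \<le> 1" using le1 by simp
  have gi: "integrable Q g"
    using g1 gnn by (intro integrableI_nonneg) (auto intro: le_less_trans)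
  have "(\<integral>x. g x \<partial>Q) \<le> 1"
    using g1 nn_integral_eq_integral[OF gi] gnn by simp
  have "(\<integral>x. L x - entropy_density (exp 1) P Q x \<partial>Q) \<le> (\<integral>x. g x - 1 \<partial>Q)"
  proof (rule integral_mono_AE)
    show "AE x in Q. L x - entropy_density (exp 1) P Q x \<le> g x - 1"
      using RNQ Dpos
    proof eventually_elim
      case (elim x)
      have "L x - ln (D x) = ln (g x)" using elim by (simp add: g_def ln_div)
      also have "\<dots> \<le> g x - 1" using elim by (intro ln_le_minus_one) (simp add: g_def)
      finally show ?case using elim by (simp add: entropy_density_def log_def)
    qed
  qed (use gi Lint int in auto)
  then show ?thesis
    using \<open>(\<integral>x. g x \<partial>Q) \<le> 1\<close> gi Lint int by (simp add: KL_divergence_def Q.prob_space)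
qed

section \<open>Grid-predictable sets\<close>

lemma space_path_sigma [simp]: "space (path_sigma T) = paths"
  unfolding path_sigma_def by (rule space_measure_of) auto

lemma sets_path_sigma:
  "sets (path_sigma T) = sigma_sets paths {{\<omega> \<in> paths. \<omega> s \<in> A} |s A. s \<in> T \<and> A \<in> sets borel}"
  unfolding path_sigma_def by (rule sets_measure_of) auto

lemma path_sigma_mono: "S \<subseteq> T \<Longrightarrow> sets (path_sigma S) \<subseteq> sets (path_sigma T)"
  unfolding sets_path_sigma by (intro sigma_sets_mono') blast

lemma measurable_path_eval: "s \<in> T \<Longrightarrow> (\<lambda>\<omega>. \<omega> s) \<in> borel_measurable (path_sigma T)"
  by (rule measurableI) (auto simp: sets_path_sigma vimage_def Int_def intro!: sigma_sets.Basic)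

lemma sets_path_sigma_subset:
  assumes "space M = paths" "\<And>s. s \<in> T \<Longrightarrow> (\<lambda>\<omega>. \<omega> s) \<in> borel_measurable M"
  shows "sets (path_sigma T) \<subseteq> sets M"
  unfolding sets_path_sigma assms(1)[symmetric]
proof (rule sets.sigma_sets_subset, safe)
  fix s and A :: "(real ^ 'a) set" assume "s \<in> T" "A \<in> sets borel"
  then show "{\<omega> \<in> space M. \<omega> s \<in> A} \<in> sets M"
    using measurable_sets[OF assms(2)[of s], of A] by (simp add: vimage_def Int_def conj_commute)
qed

text \<open>
  Continuity of paths: each \<open>X\<^sub>u\<close> is the limit of \<open>X\<^sub>q\<close> along dyadic \<open>q \<le> u\<close>.  Approaching \<open>u\<close> from below
  keeps the times inside \<open>{0..s}\<close>.
\<close>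

lemma path_filtration_dyadic:
  fixes s :: real
  assumes "s \<le> 1"
  shows "sets (path_filtration s :: (real \<Rightarrow> real ^ 'l::finite) measure)
    \<subseteq> sets (path_sigma {x \<in> {0..s}. \<exists>n k. x = real k / 2 ^ n})"
proof (rule sets_path_sigma_subset)
  let ?T = "{x \<in> {0..s}. \<exists>n k. x = real k / 2 ^ n}"
  fix u assume u: "u \<in> {0..s}"
  define q where "q n = real (nat \<lfloor>u * 2 ^ n\<rfloor>) / 2 ^ n" for n :: nat
  have fl: "real (nat \<lfloor>u * 2 ^ n\<rfloor>) = of_int \<lfloor>u * 2 ^ n\<rfloor>" for n :: nat
    using u by simp
  have q: "q n \<le> u" "u - 1 / 2 ^ n \<le> q n" "0 \<le> q n" for n
  proof -
    have "real_of_int \<lfloor>u * 2 ^ n\<rfloor> \<le> u * 2 ^ n" "u * 2 ^ n \<le> real_of_int \<lfloor>u * 2 ^ n\<rfloor> + 1" by linarith+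
    then have "real_of_int \<lfloor>u * 2 ^ n\<rfloor> / 2 ^ n \<le> u" "(u * 2 ^ n - 1) / 2 ^ n \<le> real_of_int \<lfloor>u * 2 ^ n\<rfloor> / 2 ^ n"
      by (auto simp: divide_le_eq intro!: divide_right_mono)
    then show "q n \<le> u" "u - 1 / 2 ^ n \<le> q n" unfolding q_def fl by (auto simp: diff_divide_distrib)
    show "0 \<le> q n" by (simp add: q_def)
  qed
  have "(\<lambda>n. u - 1 / 2 ^ n) \<longlonglongrightarrow> u - 0"
    by (intro tendsto_intros LIMSEQ_divide_realpow_zero) simp
  then have qlim: "q \<longlonglongrightarrow> u"
    by (intro tendsto_sandwich[of "\<lambda>n. u - 1 / 2 ^ n" q sequentially "\<lambda>_. u"]) (auto simp: q)
  show "(\<lambda>\<omega>. \<omega> u :: real ^ 'l) \<in> borel_measurable (path_sigma ?T)"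
  proof (rule borel_measurable_LIMSEQ_metric)
    show "(\<lambda>\<omega>. \<omega> (q n) :: real ^ 'l) \<in> borel_measurable (path_sigma ?T)" for n
    proof (rule measurable_path_eval)
      have "q n \<in> {0..s}" using q[of n] u by simp
      moreover have "\<exists>m k. q n = real k / 2 ^ m" unfolding q_def by blast
      ultimately show "q n \<in> ?T" by simp
    qed
    fix \<omega> :: "real \<Rightarrow> real ^ 'l" assume "\<omega> \<in> space (path_sigma ?T)"
    then have "continuous_on {0..1} \<omega>" by (simp add: paths_def)
    moreover have "q n \<in> {0..1}" for n using q[of n] u assms by auto
    ultimately show "(\<lambda>n. \<omega> (q n)) \<longlonglongrightarrow> \<omega> u"
      using u assms by (intro continuous_on_tendsto_compose[OF _ qlim]) auto
  qed
qed simp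

definition dyadic_grid :: "nat \<Rightarrow> real set" where
  "dyadic_grid n = {real k / 2 ^ n |k. k \<le> 2 ^ n}"

lemma dyadic_grid_mono: assumes "m \<le> n" shows "dyadic_grid m \<subseteq> dyadic_grid n"
proof
  fix x assume "x \<in> dyadic_grid m"
  then obtain k where k: "x = real k / 2 ^ m" "k \<le> 2 ^ m" by (auto simp: dyadic_grid_def)
  have e: "(2::'b::semiring_1) ^ n = 2 ^ m * 2 ^ (n - m)" using assms by (simp flip: power_add)
  have "x = real (k * 2 ^ (n - m)) / 2 ^ n" "k * 2 ^ (n - m) \<le> 2 ^ n"
    using k by (auto simp: e)
  then show "x \<in> dyadic_grid n" unfolding dyadic_grid_def by blast
qed

lemma dyadic_in_grid: "real k / 2 ^ n \<le> 1 \<Longrightarrow> real k / 2 ^ n \<in> dyadic_grid n"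
  by (auto simp: dyadic_grid_def divide_le_eq)

text \<open>
  The predictable sets of the dyadic grid: over each interval \<open>(k/2\<^sup>n, (k+1)/2\<^sup>n]\<close> they are cylinders
  over an event that is determined by the path at the grid points up to \<open>k/2\<^sup>n\<close>.  Time \<open>0\<close> is left
  out; it is null for \<open>dt\<close>.
\<close>

definition grid_predictable :: "nat \<Rightarrow> (real \<times> (real \<Rightarrow> real ^ 'l::finite)) measure" where
  "grid_predictable n = sigma ({0<..1} \<times> paths)
     {{q<..1} \<times> {\<omega> \<in> paths. \<omega> p \<in> U} |p q U.
        p \<in> dyadic_grid n \<and> q \<in> dyadic_grid n \<and> p \<le> q \<and> U \<in> sets borel}"

lemma grid_predictable_gen_Pow:
  "{{q<..1} \<times> {\<omega> \<in> paths. \<omega> p \<in> U} |p q U.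
      p \<in> dyadic_grid n \<and> q \<in> dyadic_grid n \<and> p \<le> q \<and> U \<in> sets borel} \<subseteq> Pow ({0<..1} \<times> paths)"
  by (auto simp: dyadic_grid_def) (meson divide_nonneg_nonneg le_less_trans of_nat_0_le_iff zero_le_numeral zero_le_power)

lemma space_grid_predictable [simp]: "space (grid_predictable n) = {0<..1} \<times> paths"
  unfolding grid_predictable_def by (rule space_measure_of[OF grid_predictable_gen_Pow])

lemma sets_grid_predictable:
  "sets (grid_predictable n) = sigma_sets ({0<..1} \<times> paths)
     {{q<..1} \<times> {\<omega> \<in> paths. \<omega> p \<in> U} |p q U.
        p \<in> dyadic_grid n \<and> q \<in> dyadic_grid n \<and> p \<le> q \<and> U \<in> sets borel}"
  unfolding grid_predictable_def by (rule sets_measure_of[OF grid_predictable_gen_Pow])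

lemma grid_predictable_mono: "m \<le> n \<Longrightarrow> sets (grid_predictable m) \<subseteq> sets (grid_predictable n)"
  unfolding sets_grid_predictable using dyadic_grid_mono[of m n]
  by (intro sigma_sets_mono') blast

text \<open>
  A grid-predictable set is constant in time on each grid interval, with a section that depends only
  on the path up to the left end.  The section is read off at the right end because the intervals
  are open on the left.
\<close>

lemma grid_predictable_section:
  assumes "E \<in> sets (grid_predictable n)" "k < 2 ^ n"
  shows "{\<omega> \<in> paths. (real (Suc k) / 2 ^ n, \<omega>) \<in> E} \<in> sets (path_sigma {real j / 2 ^ n |j. j \<le> k}) \<and>
    (\<forall>t\<in>{real k / 2 ^ n<..real (Suc k) / 2 ^ n}. \<forall>\<omega>\<in>paths. (t, \<omega>) \<in> E \<longleftrightarrow> (real (Suc k) / 2 ^ n, \<omega>) \<in> E)"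
  using assms(1) unfolding sets_grid_predictable
proof (induction rule: sigma_sets.induct)
  case (Basic E)
  then obtain p q U where E: "E = {q<..1} \<times> {\<omega> \<in> paths. \<omega> p \<in> U}"
    and pq: "p \<in> dyadic_grid n" "q \<in> dyadic_grid n" "p \<le> q" "U \<in> sets borel" by blast
  obtain i where i: "p = real i / 2 ^ n" using pq(1) by (auto simp: dyadic_grid_def)
  obtain j where j: "q = real j / 2 ^ n" using pq(2) by (auto simp: dyadic_grid_def)
  have ij: "i \<le> j" using pq(3) by (simp add: i j divide_le_cancel)
  have "real (Suc k) \<le> 2 ^ n"
    using assms(2) by (metis Suc_leI of_nat_le_iff of_nat_numeral of_nat_power)
  then have t1: "real (Suc k) / 2 ^ n \<le> 1" by simp
  have iff: "q < t \<and> t \<le> 1 \<longleftrightarrow> j \<le> k" if t: "t \<in> {real k / 2 ^ n<..real (Suc k) / 2 ^ n}" for t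
  proof
    assume "q < t \<and> t \<le> 1"
    then have "q < real (Suc k) / 2 ^ n" using t by auto
    then have "real j < real (Suc k)" by (simp add: j divide_less_cancel)
    then show "j \<le> k" by simp
  next
    assume "j \<le> k"
    then have "q \<le> real k / 2 ^ n" by (simp add: j divide_le_cancel)
    moreover have "t \<le> 1" using t t1 by (meson greaterThanAtMost_iff order_trans)
    ultimately show "q < t \<and> t \<le> 1" using t by auto
  qed
  have k1: "real (Suc k) / 2 ^ n \<in> {real k / 2 ^ n<..real (Suc k) / 2 ^ n}"
    by (simp add: divide_less_cancel)
  have "{\<omega> \<in> paths. \<omega> p \<in> U} \<in> sets (path_sigma {real j / 2 ^ n |j. j \<le> k})" if "j \<le> k"
    unfolding sets_path_sigma using pq(4) ij that i by (intro sigma_sets.Basic) fastforce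
  moreover have mem: "(t, \<omega>) \<in> E \<longleftrightarrow> j \<le> k \<and> \<omega> p \<in> U"
    if "t \<in> {real k / 2 ^ n<..real (Suc k) / 2 ^ n}" "\<omega> \<in> paths" for t \<omega>
    using iff[OF that(1)] that(2) unfolding E by auto
  moreover have "{\<omega> \<in> paths. (real (Suc k) / 2 ^ n, \<omega>) \<in> E} = (if j \<le> k then {\<omega> \<in> paths. \<omega> p \<in> U} else {})"
    using mem[OF k1] by auto
  ultimately show ?case using k1 by (simp del: of_nat_Suc)
next
  case Empty
  then show ?case by simp
next
  case (Compl E)
  have t1: "0 < t \<and> t \<le> 1" if "t \<in> {real k / 2 ^ n<..real (Suc k) / 2 ^ n}" for t
  proof -
    have "real (Suc k) \<le> 2 ^ n"
      using assms(2) by (metis Suc_leI of_nat_le_iff of_nat_numeral of_nat_power)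
    then have "real (Suc k) / 2 ^ n \<le> 1" by simp
    moreover have "0 \<le> real k / 2 ^ n" by simp
    ultimately show ?thesis using that by (meson greaterThanAtMost_iff order_trans le_less_trans)
  qed
  have k1: "real (Suc k) / 2 ^ n \<in> {real k / 2 ^ n<..real (Suc k) / 2 ^ n}"
    by (simp add: divide_less_cancel)
  define G :: "(real \<Rightarrow> real ^ 'a) measure" where "G = path_sigma {real j / 2 ^ n |j. j \<le> k}"
  have "{\<omega> \<in> paths. (real (Suc k) / 2 ^ n, \<omega>) \<in> {0<..1} \<times> paths - E}
    = space G - {\<omega> \<in> paths. (real (Suc k) / 2 ^ n, \<omega>) \<in> E}"
    using t1[OF k1] by (auto simp: G_def simp del: of_nat_Suc)
  also have "\<dots> \<in> sets G" using Compl.IH by (intro sets.compl_sets) (simp add: G_def)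
  finally have "{\<omega> \<in> paths. (real (Suc k) / 2 ^ n, \<omega>) \<in> {0<..1} \<times> paths - E} \<in> sets G" .
  moreover have "(t, \<omega>) \<in> {0<..1} \<times> paths - E \<longleftrightarrow> (real (Suc k) / 2 ^ n, \<omega>) \<in> {0<..1} \<times> paths - E"
    if "t \<in> {real k / 2 ^ n<..real (Suc k) / 2 ^ n}" "\<omega> \<in> paths" for t \<omega>
  proof -
    have "(t, \<omega>) \<in> E \<longleftrightarrow> (real (Suc k) / 2 ^ n, \<omega>) \<in> E"
      by (rule Compl.IH[THEN conjunct2, rule_format, OF that])
    then show ?thesis
      unfolding Diff_iff mem_Sigma_iff greaterThanAtMost_iff using t1[OF that(1)] t1[OF k1] that(2) by meson
  qed
  ultimately show ?case unfolding G_def by blast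
next
  case (Union E)
  have "{\<omega> \<in> paths. (real (Suc k) / 2 ^ n, \<omega>) \<in> (\<Union>i. E i)} = (\<Union>i. {\<omega> \<in> paths. (real (Suc k) / 2 ^ n, \<omega>) \<in> E i})"
    by auto
  also have "\<dots> \<in> sets (path_sigma {real j / 2 ^ n |j. j \<le> k})"
    using Union.IH[THEN conjunct1] by (intro sets.countable_nat_UN) (simp add: image_subset_iff del: of_nat_Suc)
  finally show ?case
  proof (intro conjI ballI)
    fix t and \<omega> :: "real \<Rightarrow> real ^ 'a"
    assume that: "t \<in> {real k / 2 ^ n<..real (Suc k) / 2 ^ n}" "\<omega> \<in> paths"
    show "(t, \<omega>) \<in> (\<Union>i. E i) \<longleftrightarrow> (real (Suc k) / 2 ^ n, \<omega>) \<in> (\<Union>i. E i)"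
      unfolding UN_iff using Union.IH[THEN conjunct2, rule_format, OF that] by (simp del: of_nat_Suc)
  qed
qed

text \<open>
  The generators \<open>(s,t] \<times> A\<close> are differences of sets \<open>(s,1] \<times> A\<close>.  Such a set is the union of
  \<open>(q,1] \<times> A\<close> over dyadic \<open>q \<ge> s\<close>, and \<open>A\<close> is generated by the path at dyadic times up to \<open>s\<close>; any
  two dyadic times lie on a common grid.
\<close>

lemma predictable_generated_by_grid:
  assumes "E \<in> sets (predictable_sigma :: (real \<times> (real \<Rightarrow> real ^ 'l::finite)) measure)"
  shows "E \<inter> ({0<..1} \<times> paths) \<in> sigma_sets ({0<..1} \<times> paths) (\<Union>n. sets (grid_predictable n))"
    (is "_ \<in> ?S")
proof -
  let ?O = "{0<..1::real} \<times> (paths :: (real \<Rightarrow> real ^ 'l) set)"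
  interpret S: sigma_algebra ?O ?S
    using sets.space_closed[of "grid_predictable _"] by (intro sigma_algebra_sigma_sets) auto
  define dy where "dy = {x::real. \<exists>n k. x = real k / 2 ^ n}"
  have cdy: "countable dy"
  proof -
    have "dy = range (\<lambda>(n, k). real k / 2 ^ n)" by (auto simp: dy_def)
    then show ?thesis by simp
  qed
  have basic: "{q<..1} \<times> A \<in> ?S" if q: "q \<in> dy" "0 \<le> q" "q \<le> 1" and A: "A \<in> sets (path_filtration q)" for q A
  proof -
    obtain n j where qn: "q = real j / 2 ^ n" using q by (auto simp: dy_def)
    have gen: "{q<..1} \<times> {\<omega> \<in> paths. \<omega> p \<in> U} \<in> ?S"
      if p: "p \<in> {0..q}" "p \<in> dy" "U \<in> sets borel" for p U
    proof -
      obtain m i where pm: "p = real i / 2 ^ m" using p by (auto simp: dy_def)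
      have "p \<le> 1" using p q by simp
      then have "p \<in> dyadic_grid m" "q \<in> dyadic_grid n"
        using dyadic_in_grid[of i m] dyadic_in_grid[of j n] q qn pm by auto
      then have "p \<in> dyadic_grid (max m n)" "q \<in> dyadic_grid (max m n)"
        using dyadic_grid_mono[of m "max m n"] dyadic_grid_mono[of n "max m n"] by auto
      then have "{q<..1} \<times> {\<omega> \<in> paths. \<omega> p \<in> U} \<in> sets (grid_predictable (max m n))"
        unfolding sets_grid_predictable using p by (intro sigma_sets.Basic) auto
      then show ?thesis by (intro sigma_sets.Basic) auto
    qed
    have "A \<in> sigma_sets paths {{\<omega> \<in> paths. \<omega> p \<in> U} |p U. p \<in> {x \<in> {0..q}. x \<in> dy} \<and> U \<in> sets borel}"
      using A path_filtration_dyadic[OF q(3)] unfolding sets_path_sigma[of "{x \<in> {0..q}. _ x}"] dy_def by auto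
    then show ?thesis
    proof (induction rule: sigma_sets.induct)
      case (Basic A)
      then show ?case using gen by auto
    next
      case Empty
      then show ?case by simp
    next
      case (Compl A)
      have "{q<..1} \<times> {\<omega> \<in> paths. \<omega> q \<in> UNIV} \<in> ?S" using q by (intro gen) auto
      then have "{q<..1} \<times> {\<omega> \<in> paths. \<omega> q \<in> UNIV} - {q<..1} \<times> A \<in> ?S" using Compl by blast
      moreover have "{q<..1} \<times> {\<omega> \<in> paths. \<omega> q \<in> UNIV} - {q<..1} \<times> A = {q<..1} \<times> (paths - A)" by auto
      ultimately show ?case by metis
    next
      case (Union A)
      have "{q<..1} \<times> (\<Union>i. A i) = (\<Union>i. {q<..1} \<times> A i)" by auto
      then show ?case using Union.IH by (auto intro!: S.countable_nat_UN)
    qed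
  qed
  have half: "{s<..1} \<times> A \<in> ?S" if s: "0 \<le> s" "s \<le> 1" and A: "A \<in> sets (path_filtration s)" for s A
  proof -
    have "{s<..1} \<times> A = (\<Union>q\<in>{q \<in> dy. s \<le> q \<and> q \<le> 1}. {q<..1} \<times> A)"
    proof safe
      fix t \<omega> assume t: "t \<in> {s<..1}" "\<omega> \<in> A"
      obtain n where n: "inverse (2 ^ n) < t - s" using real_arch_pow_inv[of "t - s" "1/2"] t by (auto simp: power_one_over inverse_eq_divide)
      define k where "k = nat \<lceil>s * 2 ^ n\<rceil>"
      have rk: "real k = of_int \<lceil>s * 2 ^ n\<rceil>" using s by (simp add: k_def)
      have "s * 2 ^ n \<le> real k" "real k < s * 2 ^ n + 1" unfolding rk by linarith+
      then have "s \<le> real k / 2 ^ n" "real k / 2 ^ n < s + inverse (2 ^ n)" by (auto simp: field_simps)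
      moreover from this have "real k / 2 ^ n < t" using n by linarith
      then have "real k / 2 ^ n \<le> 1" using t by (meson greaterThanAtMost_iff less_imp_le order_trans)
      then have "k \<le> 2 ^ n" by (auto simp: divide_le_eq)
      ultimately show "(t, \<omega>) \<in> (\<Union>q\<in>{q \<in> dy. s \<le> q \<and> q \<le> 1}. {q<..1} \<times> A)"
        using t n by (auto simp: dy_def intro!: exI[of _ "real k / 2 ^ n"])
    qed auto
    also have "\<dots> \<in> ?S"
    proof (rule S.countable_UN')
      show "countable {q \<in> dy. s \<le> q \<and> q \<le> 1}" using cdy by (rule countable_subset[rotated]) auto
      show "(\<lambda>q. {q<..1} \<times> A) ` {q \<in> dy. s \<le> q \<and> q \<le> 1} \<subseteq> ?S"
      proof safe
        fix q assume "q \<in> dy" "s \<le> q" "q \<le> 1"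
        then show "{q<..1} \<times> A \<in> ?S"
          using s A path_sigma_mono[of "{0..s}" "{0..q}"] by (intro basic) auto
      qed
    qed
    finally show ?thesis .
  qed
  have Ap: "A \<subseteq> paths" if "A \<in> sets (path_filtration s)" for A :: "(real \<Rightarrow> real ^ 'l) set" and s
    using sets.sets_into_space[OF that] by simp
  have gen: "{{0} \<times> A |A. A \<in> sets (path_filtration 0)} \<union>
      {{s<..t} \<times> A |s t A. 0 \<le> s \<and> s < t \<and> t \<le> 1 \<and> A \<in> sets (path_filtration s)} \<subseteq> Pow ({0..1} \<times> (paths :: (real \<Rightarrow> real ^ 'l) set))"
    using Ap by fastforce
  have "E \<in> sigma_sets ({0..1} \<times> paths) ({{0} \<times> A |A. A \<in> sets (path_filtration 0)} \<union>
      {{s<..t} \<times> A |s t A. 0 \<le> s \<and> s < t \<and> t \<le> 1 \<and> A \<in> sets (path_filtration s)})"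
    using assms sets_measure_of[OF gen] unfolding predictable_sigma_def by simp
  then show ?thesis
  proof (induction rule: sigma_sets.induct)
    case (Basic E)
    then consider A where "E = {0} \<times> A" |
      s t A where "E = {s<..t} \<times> A" "0 \<le> s" "s < t" "t \<le> 1" "A \<in> sets (path_filtration s)" by blast
    then show ?case
    proof cases
      case 1
      then have "E \<inter> ?O = {}" by auto
      then show ?thesis by simp
    next
      case 2
      have "A \<in> sets (path_filtration t)" using 2 path_sigma_mono[of "{0..s}" "{0..t}"] by auto
      then have "{s<..1} \<times> A - {t<..1} \<times> A \<in> ?S" using 2 by (intro S.Diff half) auto
      moreover have "E \<inter> ?O = {s<..1} \<times> A - {t<..1} \<times> A" using 2 Ap[OF 2(5)] by auto
      ultimately show ?thesis by simp
    qed
  next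
    case Empty
    then show ?case by simp
  next
    case (Compl E)
    have "({0..1} \<times> paths - E) \<inter> ?O = ?O - E \<inter> ?O" by auto
    then show ?case using Compl by auto
  next
    case (Union E)
    have eq: "(\<Union>i. E i) \<inter> ?O = (\<Union>i. E i \<inter> ?O)" by auto
    show ?case unfolding eq by (rule sigma_sets.Union) (rule Union.IH)
  qed
qed

text \<open>
  The sets that can be approximated from some level form a sigma-algebra.  For a countable union, cut off
  to finitely many sets by continuity of the measure, approximate these, and pass to a common level.
\<close>

lemma approx_by_increasing_sigma_algebras:
  assumes nu: "finite_measure nu" and sub: "\<And>n. sets (P n) \<subseteq> sets nu" and sp: "\<And>n. space (P n) = space nu"
    and mono: "\<And>m n. m \<le> n \<Longrightarrow> sets (P m) \<subseteq> sets (P n)"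
    and E: "E \<in> sigma_sets (space nu) (\<Union>n :: nat. sets (P n))" and e: "(0::real) < e"
  shows "\<exists>n. \<exists>A\<in>sets (P n). measure nu ((E - A) \<union> (A - E)) < e"
proof -
  interpret finite_measure nu by fact
  have UP: "(\<Union>n. sets (P n)) \<subseteq> sets nu" using sub by auto
  have SM: "A \<in> sets nu" if "A \<in> sigma_sets (space nu) (\<Union>n. sets (P n))" for A
    using that sets.sigma_sets_subset[OF UP] by auto
  show ?thesis using E e
  proof (induction arbitrary: e rule: sigma_sets.induct)
    case (Basic E)
    then show ?case by (auto intro!: bexI[of _ E])
  next
    case Empty
    then show ?case by (auto intro!: exI[of _ 0] bexI[of _ "{}"])
  next
    case (Compl E)
    then obtain n A where A: "A \<in> sets (P n)" "measure nu ((E - A) \<union> (A - E)) < e" by blast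
    have "A \<subseteq> space nu" using sets.sets_into_space[OF A(1)] sp by auto
    moreover have "E \<subseteq> space nu" using sets.sets_into_space[OF SM[OF Compl.hyps]] .
    ultimately have "(space nu - E - (space nu - A)) \<union> (space nu - A - (space nu - E)) = (E - A) \<union> (A - E)" by auto
    then show ?case using A sets.compl_sets[OF A(1)] sp
      by (intro exI[of _ n] bexI[of _ "space nu - A"]) auto
  next
    case (Union E)
    have Em: "E i \<in> sets nu" for i using SM Union.hyps by auto
    have "(\<lambda>N. measure nu (\<Union>i<N. E i)) \<longlonglongrightarrow> measure nu (\<Union>N. \<Union>i<N. E i)"
    proof (rule finite_Lim_measure_incseq)
      show "incseq (\<lambda>N. \<Union>i<N. E i)" unfolding incseq_def by (intro allI impI UN_mono) auto
    qed (use Em in auto)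
    moreover have "(\<Union>N. \<Union>i<N. E i) = (\<Union>i. E i)" by auto
    ultimately have "(\<lambda>N. measure nu (\<Union>i<N. E i)) \<longlonglongrightarrow> measure nu (\<Union>i. E i)" by metis
    then have "\<forall>\<^sub>F N in sequentially. measure nu (\<Union>i<N. E i) > measure nu (\<Union>i. E i) - e / 2"
      by (rule order_tendstoD(1)) (use Union.prems in simp)
    then obtain N where N: "measure nu (\<Union>i<N. E i) > measure nu (\<Union>i. E i) - e / 2"
      by (auto simp: eventually_sequentially)
    \<comment> \<open>Half of \<open>e\<close> pays for the cut-off, the other half for the \<open>N\<close> approximations.\<close>
    define d where "d = e / (2 * real (Suc N))"
    have d: "0 < d" using Union.prems by (simp add: d_def)
    have "\<forall>i. \<exists>n A. A \<in> sets (P n) \<and> measure nu ((E i - A) \<union> (A - E i)) < d"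
      using Union.IH d by blast
    then obtain n A where A: "\<And>i. A i \<in> sets (P (n i))" "\<And>i. measure nu ((E i - A i) \<union> (A i - E i)) < d"
      by metis
    define m where "m = Max (n ` {..N})"
    have "A i \<in> sets (P m)" if "i < N" for i
      using A(1)[of i] mono[of "n i" m] that by (auto simp: m_def)
    then have Um: "(\<Union>i<N. A i) \<in> sets (P m)" by auto
    have Am: "A i \<in> sets nu" for i using A(1) sub by blast
    let ?B = "\<Union>i<N. A i"
    have "measure nu (((\<Union>i. E i) - ?B) \<union> (?B - (\<Union>i. E i)))
       \<le> measure nu (((\<Union>i. E i) - (\<Union>i<N. E i)) \<union> (\<Union>i<N. (E i - A i) \<union> (A i - E i)))"
      using Em Am by (intro finite_measure_mono) auto
    also have "\<dots> \<le> measure nu ((\<Union>i. E i) - (\<Union>i<N. E i)) + measure nu (\<Union>i<N. (E i - A i) \<union> (A i - E i))"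
      using Em Am by (intro measure_Un_le) auto
    also have "measure nu ((\<Union>i. E i) - (\<Union>i<N. E i)) = measure nu (\<Union>i. E i) - measure nu (\<Union>i<N. E i)"
      using Em by (intro finite_measure_Diff) auto
    also have "measure nu (\<Union>i<N. (E i - A i) \<union> (A i - E i)) \<le> (\<Sum>i<N. measure nu ((E i - A i) \<union> (A i - E i)))"
      using Em Am by (intro finite_measure_subadditive_finite) auto
    also have "\<dots> \<le> (\<Sum>i<N. d)" using A(2) by (intro sum_mono less_imp_le)
    also have "\<dots> \<le> e / 2" using Union.prems by (simp add: d_def field_simps)
    finally have "measure nu (((\<Union>i. E i) - ?B) \<union> (?B - (\<Union>i. E i))) < e" using N by simp
    then show ?case using Um by blast
  qed
qed

section \<open>Gaussian likelihood ratios under Wiener measure\<close>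

text \<open>
  The matrix \<open>x x\<^sup>t\<close>, whose mean is the matrix of second moments of \<open>x\<close>.
\<close>

definition outer_square :: "real ^ 'n \<Rightarrow> real ^ 'n ^ 'n::finite" where
  "outer_square x = (\<chi> a b. x $ a * x $ b)"

text \<open>
  This identifies the gain at \<open>x x\<^sup>t\<close> with a log-likelihood ratio at \<open>x\<close>.  The factor \<open>c\<close> allows for
  increments of variance \<open>1/c\<close>.
\<close>

lemma gauss_gain_outer_square:
  fixes T :: "real ^ 'n ^ 'n::finite"
  shows "gauss_gain T (c *\<^sub>R outer_square x) = ln \<bar>det T\<bar> - c / 2 * ((norm (T *v x))\<^sup>2 - (norm x)\<^sup>2)"
proof -
  have 1: "(\<Sum>a\<in>UNIV. \<Sum>b\<in>UNIV. (transpose T ** T) $ a $ b * (x $ a * x $ b)) = (norm (T *v x))\<^sup>2"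
  proof -
    have "(norm (T *v x))\<^sup>2 = (\<Sum>i\<in>UNIV. \<Sum>a\<in>UNIV. \<Sum>b\<in>UNIV. (T $ i $ a * x $ a) * (T $ i $ b * x $ b))"
      by (simp add: power2_norm_eq_inner inner_vec_def matrix_vector_mult_def sum_product)
    also have "\<dots> = (\<Sum>a\<in>UNIV. \<Sum>i\<in>UNIV. \<Sum>b\<in>UNIV. (T $ i $ a * x $ a) * (T $ i $ b * x $ b))"
      by (rule sum.swap)
    also have "\<dots> = (\<Sum>a\<in>UNIV. \<Sum>b\<in>UNIV. \<Sum>i\<in>UNIV. (T $ i $ a * x $ a) * (T $ i $ b * x $ b))"
      by (intro sum.cong refl sum.swap)
    also have "\<dots> = (\<Sum>a\<in>UNIV. \<Sum>b\<in>UNIV. (transpose T ** T) $ a $ b * (x $ a * x $ b))"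
      unfolding matrix_matrix_mult_def transpose_def vec_lambda_beta sum_distrib_right
      by (intro sum.cong refl) (simp add: mult_ac)
    finally show ?thesis by simp
  qed
  have 2: "(\<Sum>a\<in>UNIV. \<Sum>b\<in>UNIV. mat 1 $ a $ b * (x $ a * x $ b)) = (norm x)\<^sup>2"
    by (simp add: power2_norm_eq_inner inner_vec_def mat_def if_distrib[of "\<lambda>x. x * _"] cong: if_cong)
  have "(\<Sum>a\<in>UNIV. \<Sum>b\<in>UNIV. ((transpose T ** T) $ a $ b - mat 1 $ a $ b) * (c *\<^sub>R outer_square x) $ a $ b)
    = c * (\<Sum>a\<in>UNIV. \<Sum>b\<in>UNIV. ((transpose T ** T) $ a $ b - mat 1 $ a $ b) * (x $ a * x $ b))"
    by (simp add: outer_square_def sum_distrib_left mult.left_commute)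
  also have "\<dots> = c * ((norm (T *v x))\<^sup>2 - (norm x)\<^sup>2)"
    by (simp only: left_diff_distrib sum_subtractf 1 2)
  finally show ?thesis by (simp add: gauss_gain_def)
qed

lemma prod_normal_density:
  fixes x :: "real ^ 'n::finite"
  assumes "0 < \<sigma>"
  shows "(\<Prod>i\<in>UNIV. normal_density 0 \<sigma> (x $ i))
    = (1 / sqrt (2 * pi * \<sigma>\<^sup>2)) ^ CARD('n) * exp (- (norm x)\<^sup>2 / (2 * \<sigma>\<^sup>2))"
proof -
  have "(norm x)\<^sup>2 = (\<Sum>i\<in>UNIV. (x $ i)\<^sup>2)"
    by (simp add: norm_vec_def L2_set_def real_sqrt_pow2 sum_nonneg)
  then show ?thesis
    by (simp add: normal_density_def prod.distrib exp_sum[symmetric] sum_negf sum_divide_distrib power_divide prod_dividef)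
qed

lemma wiener_measure_factor:
  fixes B :: "(real \<Rightarrow> real ^ 'l::finite) measure"
  assumes B: "is_wiener_measure B" and st: "0 \<le> s" "s < t" "t \<le> 1"
    and Y[measurable]: "Y \<in> borel_measurable (path_filtration s)"
    and h[measurable]: "h \<in> borel_measurable borel"
  shows "(\<integral>\<^sup>+\<omega>. Y \<omega> * h (\<omega> t - \<omega> s) \<partial>B) = (\<integral>\<^sup>+\<omega>. Y \<omega> \<partial>B) * (\<integral>\<^sup>+\<omega>. h (\<omega> t - \<omega> s) \<partial>B)"
proof -
  have sB: "sets B = sets (path_filtration 1)" and "prob_space B"
    using B by (auto simp: is_wiener_measure_def is_path_law_def)
  interpret prob_space B by fact
  have spB: "space B = paths" using sets_eq_imp_space_eq[OF sB] by simp
  define X where "X \<omega> = h (\<omega> t - \<omega> s)" for \<omega> :: "real \<Rightarrow> real ^ 'l"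
  have ev: "(\<lambda>\<omega>. \<omega> u) \<in> borel_measurable B" if "u \<in> {0..1}" for u
    using measurable_path_eval[OF that] measurable_cong_sets[OF sB refl] by blast
  have [measurable]: "(\<lambda>\<omega>. \<omega> t) \<in> borel_measurable B" "(\<lambda>\<omega>. \<omega> s) \<in> borel_measurable B"
    using st by (auto intro!: ev)
  have Xm: "X \<in> borel_measurable B" unfolding X_def by measurable
  have Fs: "sets (path_filtration s) \<subseteq> sets B"
    unfolding sB using st by (intro path_sigma_mono) auto
  have Ym: "Y \<in> borel_measurable B"
    using Y Fs spB by (auto simp: measurable_def)
  have ind: "indep_set (sets (path_filtration s)) {{\<omega> \<in> paths. \<omega> t - \<omega> s \<in> A} |A. A \<in> sets borel}"
    using B st by (auto simp: is_wiener_measure_def)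
  have "indep_set {Y -` A \<inter> space B |A. A \<in> sets borel} {X -` A \<inter> space B |A. A \<in> sets borel}"
    unfolding indep_sets2_eq
  proof (intro conjI ballI)
    show "{Y -` A \<inter> space B |A. A \<in> sets borel} \<subseteq> events" "{X -` A \<inter> space B |A. A \<in> sets borel} \<subseteq> events"
      using Xm Ym by (auto intro: measurable_sets)
    fix a b assume a: "a \<in> {Y -` A \<inter> space B |A. A \<in> sets borel}" and b: "b \<in> {X -` A \<inter> space B |A. A \<in> sets borel}"
    have "a \<in> sets (path_filtration s)" using a measurable_sets[OF Y] spB by auto
    moreover obtain A where A: "b = X -` A \<inter> space B" "A \<in> sets borel" using b by auto
    have "b = {\<omega> \<in> paths. \<omega> t - \<omega> s \<in> h -` A}" using A spB by (auto simp: X_def)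
    moreover have "h -` A \<in> sets borel" using measurable_sets[OF h A(2)] by simp
    ultimately show "prob (a \<inter> b) = prob a * prob b"
      using ind unfolding indep_sets2_eq by blast
  qed
  then have "indep_set (sigma_sets (space B) {Y -` A \<inter> space B |A. A \<in> sets borel})
      (sigma_sets (space B) {X -` A \<inter> space B |A. A \<in> sets borel})"
    by (intro indep_set_sigma_sets) (auto simp: Int_stable_def intro: exI[of _ "_ \<inter> _"])
  then have "indep_var borel Y borel X"
    unfolding indep_var_eq using Xm Ym by simp
  then have iv: "indep_vars (\<lambda>_. borel) (case_bool Y X) UNIV"
    unfolding indep_var_def by (rule indep_vars_cong[THEN iffD1, rotated -1]) (auto split: bool.split)
  have "(\<integral>\<^sup>+\<omega>. (\<Prod>i\<in>UNIV. case_bool Y X i \<omega>) \<partial>B) = (\<Prod>i\<in>UNIV. \<integral>\<^sup>+\<omega>. case_bool Y X i \<omega> \<partial>B)"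
    by (rule indep_vars_nn_integral[OF _ iv]) auto
  then show ?thesis by (simp add: UNIV_bool X_def[abs_def] mult.commute)
qed

text \<open>
  The increment is independent of the past, so its likelihood ratio can be integrated separately.
  Multiplied by the Gaussian density it is \<open>\<bar>det T\<bar>\<close> times the Gaussian density at \<open>T x\<close>, which
  integrates to \<open>1\<close> by the linear change of variables.
\<close>

lemma wiener_measure_gauss_step:
  fixes B :: "(real \<Rightarrow> real ^ 'l::finite) measure"
  assumes B: "is_wiener_measure B" and st: "0 \<le> s" "s < t" "t \<le> 1"
    and Y[measurable]: "Y \<in> borel_measurable (path_filtration s)" and T: "det T \<noteq> 0"
  shows "(\<integral>\<^sup>+\<omega>. Y \<omega> * ennreal (exp (gauss_gain T ((1 / (t - s)) *\<^sub>R outer_square (\<omega> t - \<omega> s)))) \<partial>B) = (\<integral>\<^sup>+\<omega>. Y \<omega> \<partial>B)"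
proof -
  have sB: "sets B = sets (path_filtration 1)" and "prob_space B"
    using B by (auto simp: is_wiener_measure_def is_path_law_def)
  interpret prob_space B by fact
  let ?f = "\<lambda>x :: real ^ 'l. ennreal (\<Prod>i\<in>UNIV. normal_density 0 (sqrt (t - s)) (x $ i))"
  have dist: "distributed B lborel (\<lambda>\<omega>. \<omega> t - \<omega> s) ?f"
    using B st by (auto simp: is_wiener_measure_def)
  define h where "h x = ennreal (exp (gauss_gain T ((1 / (t - s)) *\<^sub>R outer_square x)))" for x
  have mT[measurable]: "(\<lambda>x. T *v x) \<in> borel_measurable borel"
    by (intro borel_measurable_continuous_onI linear_continuous_on linear_conv_bounded_linear[THEN iffD1]) simp
  have hm[measurable]: "h \<in> borel_measurable borel"
    unfolding h_def gauss_gain_outer_square by measurable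
  have [measurable]: "?f \<in> borel_measurable borel" by measurable
  have fh: "?f x * h x = ennreal \<bar>det T\<bar> * ?f (T *v x)" for x
  proof -
    have "(\<Prod>i\<in>UNIV. normal_density 0 (sqrt (t - s)) (x $ i)) * exp (gauss_gain T ((1 / (t - s)) *\<^sub>R outer_square x))
      = \<bar>det T\<bar> * (\<Prod>i\<in>UNIV. normal_density 0 (sqrt (t - s)) ((T *v x) $ i))"
    proof -
      define c where "c = (1 / sqrt (2 * pi * (sqrt (t - s))\<^sup>2)) ^ CARD('l)"
      have p: "(\<Prod>i\<in>UNIV. normal_density 0 (sqrt (t - s)) (y $ i)) = c * exp (- (norm y)\<^sup>2 / (2 * (t - s)))" for y :: "real ^ 'l"
        using st by (subst prod_normal_density) (auto simp: c_def)
      have "exp (gauss_gain T ((1 / (t - s)) *\<^sub>R outer_square x))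
        = \<bar>det T\<bar> * exp (- ((norm (T *v x))\<^sup>2 - (norm x)\<^sup>2) / (2 * (t - s)))"
      proof -
        have "gauss_gain T ((1 / (t - s)) *\<^sub>R outer_square x)
          = ln \<bar>det T\<bar> + - ((norm (T *v x))\<^sup>2 - (norm x)\<^sup>2) / (2 * (t - s))"
        proof -
          have "a - 1 / c / 2 * d = a + - d / (2 * c)" for a c d :: real by simp
          then show ?thesis unfolding gauss_gain_outer_square by blast
        qed
        then show ?thesis using T by (simp only: exp_add) simp
      qed
      moreover have "exp (- (norm x)\<^sup>2 / (2 * (t - s))) * exp (- ((norm (T *v x))\<^sup>2 - (norm x)\<^sup>2) / (2 * (t - s)))
        = exp (- (norm (T *v x))\<^sup>2 / (2 * (t - s)))"
        by (simp add: exp_add[symmetric] diff_divide_distrib)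
      ultimately show ?thesis unfolding p by (simp add: mult.assoc mult.left_commute[of _ "\<bar>det T\<bar>"])
    qed
    then show ?thesis
      by (simp add: h_def ennreal_mult[symmetric] prod_nonneg)
  qed
  have "(\<integral>\<^sup>+\<omega>. h (\<omega> t - \<omega> s) \<partial>B) = (\<integral>\<^sup>+x. ?f x * h x \<partial>lborel)"
    by (rule distributed_nn_integral[OF dist, symmetric]) simp
  also have "\<dots> = (\<integral>\<^sup>+x. ennreal \<bar>det (matrix ((*v) T))\<bar> * ?f (T *v x) \<partial>lborel)"
    unfolding fh by simp
  also have "\<dots> = (\<integral>\<^sup>+x. ?f x \<partial>lborel)"
    by (rule nn_integral_lborel_linear) (use T in auto)
  also have "\<dots> = (\<integral>\<^sup>+x. ?f x * 1 \<partial>lborel)" by simp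
  also have "\<dots> = (\<integral>\<^sup>+\<omega>. 1 \<partial>B)"
    by (rule distributed_nn_integral[OF dist]) simp
  also have "\<dots> = 1" by (simp add: emeasure_space_1)
  finally show ?thesis
    using wiener_measure_factor[OF B st Y hm] by (simp add: h_def)
qed

section \<open>Martingales with absolutely continuous covariation\<close>

lemma pos_semidef_diag_nonneg:
  assumes "pos_semidef S" shows "0 \<le> S $ a $ a"
proof -
  have "0 \<le> axis a 1 \<bullet> (S *v axis a 1)" using assms by (simp add: pos_semidef_def)
  then show ?thesis by (simp add: matrix_vector_mult_basis column_def inner_axis')
qed

text \<open>
  Test positivity on \<open>e\<^sub>a \<plusminus> e\<^sub>b\<close> to get \<open>2 \<bar>S\<^sub>a\<^sub>b\<bar> \<le> S\<^sub>a\<^sub>a + S\<^sub>b\<^sub>b\<close>.  Integrability of the entries of \<open>\<Sigma>\<close> thereby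
  follows from that of its diagonal.
\<close>

lemma pos_semidef_entry_le_trace:
  assumes S: "pos_semidef S" shows "\<bar>S $ a $ b\<bar> \<le> trace S"
proof -
  have q: "0 \<le> (axis a 1 + c *\<^sub>R axis b 1) \<bullet> (S *v (axis a 1 + c *\<^sub>R axis b 1))" for c
    using S by (simp add: pos_semidef_def)
  have "transpose S = S" using S by (simp add: pos_semidef_def)
  then have "transpose S $ a $ b = S $ a $ b" by simp
  then have sym: "S $ b $ a = S $ a $ b" by (simp add: transpose_def)
  have q': "0 \<le> S $ a $ a + 2 * c * S $ a $ b + c\<^sup>2 * S $ b $ b" for c
    using q[of c] by (simp add: matrix_vector_right_distrib matrix_vector_mult_scaleR matrix_vector_mult_basis
        column_def inner_axis' inner_add_left inner_add_right sym algebra_simps power2_eq_square)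
  have "2 * \<bar>S $ a $ b\<bar> \<le> S $ a $ a + S $ b $ b"
    using q'[of 1] q'[of "-1"] by (simp add: abs_le_iff)
  moreover have "S $ i $ i \<le> trace S" for i
    unfolding trace_def by (rule member_le_sum) (auto intro: pos_semidef_diag_nonneg[OF S])
  ultimately show ?thesis by (smt (verit))
qed

lemma measurable_path_eval_nth: "s \<in> T \<Longrightarrow> (\<lambda>\<omega>. \<omega> s $ i) \<in> borel_measurable (path_sigma T)"
  by (rule measurable_compose[OF measurable_path_eval]) simp_all

locale martingale_with_covariance_density =
  fixes Q :: "(real \<Rightarrow> real ^ 'l::finite) measure"
    and V \<Sigma> :: "real \<Rightarrow> (real \<Rightarrow> real ^ 'l) \<Rightarrow> real ^ 'l ^ 'l"
  assumes law: "is_path_law Q"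
    and mart: "canonical_square_integrable_martingale Q"
    and qcov: "\<And>i j. is_quadratic_covariation Q i j (\<lambda>t \<omega>. V t \<omega> $ i $ j)"
    and pred: "(\<lambda>(t, \<omega>). \<Sigma> t \<omega>) \<in> borel_measurable predictable_sigma"
    and psd: "\<And>t \<omega>. t \<in> {0..1} \<Longrightarrow> \<omega> \<in> paths \<Longrightarrow> pos_semidef (\<Sigma> t \<omega>)"
    and dens: "AE \<omega> in Q. set_integrable lborel {0..1} (\<lambda>s. \<Sigma> s \<omega>) \<and>
           (\<forall>t\<in>{0..1}. V t \<omega> = (LINT s:{0..t}|lborel. \<Sigma> s \<omega>))"
begin

lemma sets_Q: "sets Q = sets (path_filtration 1)"
  using law by (simp add: is_path_law_def)

lemma space_Q: "space Q = paths"
  using sets_eq_imp_space_eq[OF sets_Q] by simp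

sublocale prob_space Q
  using law by (simp add: is_path_law_def)

lemma sets_path_sigma_Q: "T \<subseteq> {0..1} \<Longrightarrow> sets (path_sigma T) \<subseteq> sets Q"
  unfolding sets_Q by (rule path_sigma_mono)

lemma subalgebra_path_sigma: "T \<subseteq> {0..1} \<Longrightarrow> subalgebra Q (path_sigma T)"
  using sets_path_sigma_Q by (simp add: subalgebra_def space_Q)

lemma measurable_path_sigma_Q:
  "T \<subseteq> {0..1} \<Longrightarrow> f \<in> measurable (path_sigma T) N \<Longrightarrow> f \<in> measurable Q N"
  using subalgebra_path_sigma measurable_from_subalg by blast

lemma eval_measurable [measurable]: "t \<in> {0..1} \<Longrightarrow> (\<lambda>\<omega>. \<omega> t) \<in> borel_measurable Q"
  by (rule measurable_path_sigma_Q[of "{0..1}"]) (auto intro: measurable_path_eval)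

lemma eval_nth_measurable: "t \<in> {0..1} \<Longrightarrow> (\<lambda>\<omega>. \<omega> t $ i) \<in> borel_measurable Q"
  by (rule measurable_path_sigma_Q[of "{0..1}"]) (auto intro: measurable_path_eval_nth)

text \<open>
  The martingale property in the form in which it is used: tested against a multiplier that is measurable
  at the earlier time and only has to make the product integrable.
\<close>

lemma martingale_integral_eq:
  assumes M: "is_martingale Q M" and st: "0 \<le> s" "s \<le> t" "t \<le> 1"
    and f: "f \<in> borel_measurable (path_filtration s)" and int: "integrable Q (\<lambda>\<omega>. f \<omega> * M t \<omega>)"
  shows "(\<integral>\<omega>. f \<omega> * M t \<omega> \<partial>Q) = (\<integral>\<omega>. f \<omega> * M s \<omega> \<partial>Q)"
proof -
  have sub: "subalgebra Q (path_filtration s)" using st by (intro subalgebra_path_sigma) auto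
  interpret finite_measure_subalgebra Q "path_filtration s"
    using sub by unfold_locales
  have Mm: "M t \<in> borel_measurable Q" "M s \<in> borel_measurable Q" and ce: "AE \<omega> in Q. real_cond_exp Q (path_filtration s) (M t) \<omega> = M s \<omega>"
    using M st unfolding is_martingale_def by (auto dest: borel_measurable_integrable)
  have [measurable]: "f \<in> borel_measurable Q" using measurable_from_subalg[OF sub f] .
  note [measurable] = Mm
  have "(\<integral>\<omega>. f \<omega> * M t \<omega> \<partial>Q) = (\<integral>\<omega>. f \<omega> * real_cond_exp Q (path_filtration s) (M t) \<omega> \<partial>Q)"
    by (rule real_cond_exp_intg(2)[OF int f Mm(1), symmetric])
  also have "\<dots> = (\<integral>\<omega>. f \<omega> * M s \<omega> \<partial>Q)"
    by (intro integral_cong_AE) (use ce in auto)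
  finally show ?thesis .
qed

lemma covariance_density_entries:
  "AE \<omega> in Q. \<forall>a b. set_integrable lborel {0..1} (\<lambda>s. \<Sigma> s \<omega> $ a $ b) \<and>
     (\<forall>t\<in>{0..1}. V t \<omega> $ a $ b = (LINT s:{0..t}|lborel. \<Sigma> s \<omega> $ a $ b))"
  using dens
proof eventually_elim
  case (elim \<omega>)
  have bl: "bounded_linear (\<lambda>S :: real ^ 'l ^ 'l. S $ a $ b)" for a b
    using bounded_linear_compose[OF bounded_linear_vec_nth bounded_linear_vec_nth, of a b] by simp
  have int: "set_integrable lborel {0..t} (\<lambda>s. \<Sigma> s \<omega>)" if "t \<in> {0..1}" for t
    by (rule set_integrable_subset[OF conjunct1[OF elim]]) (use that in auto)
  have comp: "set_integrable lborel {0..t} (\<lambda>s. \<Sigma> s \<omega> $ a $ b)"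
    "(LINT s:{0..t}|lborel. \<Sigma> s \<omega> $ a $ b) = (LINT s:{0..t}|lborel. \<Sigma> s \<omega>) $ a $ b" if "t \<in> {0..1}" for t a b
    using integrable_bounded_linear[OF bl[of a b] int[OF that, unfolded set_integrable_def]]
      integral_bounded_linear[OF bl[of a b] int[OF that, unfolded set_integrable_def]]
    by (simp_all add: set_integrable_def set_lebesgue_integral_def)
  show ?case using comp[of 1] comp(2) elim by simp
qed

abbreviation "unit_time \<equiv> restrict_space lborel {0<..1::real}"

abbreviation "time_path \<equiv> unit_time \<Otimes>\<^sub>M Q"

lemma covariance_increment:
  "AE \<omega> in Q. \<forall>a b. integrable unit_time (\<lambda>u. \<Sigma> u \<omega> $ a $ b) \<and>
    (\<forall>s t. 0 \<le> s \<and> s \<le> t \<and> t \<le> 1 \<longrightarrow>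
       (\<integral>u. indicator {s<..t} u * \<Sigma> u \<omega> $ a $ b \<partial>unit_time) = V t \<omega> $ a $ b - V s \<omega> $ a $ b)"
  using covariance_density_entries
proof eventually_elim
  case (elim \<omega>)
  show ?case
  proof (intro allI conjI impI)
    fix a b
    have i: "set_integrable lborel {0..1} (\<lambda>s. \<Sigma> s \<omega> $ a $ b)" using elim by blast
    have "set_integrable lborel {0<..1} (\<lambda>s. \<Sigma> s \<omega> $ a $ b)"
      by (rule set_integrable_subset[OF i]) auto
    then show "integrable unit_time (\<lambda>u. \<Sigma> u \<omega> $ a $ b)"
      by (simp add: integrable_restrict_space set_integrable_def)
    fix s t :: real assume st: "0 \<le> s \<and> s \<le> t \<and> t \<le> 1"
    have "(LINT s:{0..t}|lborel. \<Sigma> s \<omega> $ a $ b) = (LINT s:{0..s} \<union> {s<..t}|lborel. \<Sigma> s \<omega> $ a $ b)"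
      using st by (intro arg_cong2[where f="\<lambda>A. set_lebesgue_integral lborel A"] refl) auto
    also have "\<dots> = (LINT s:{0..s}|lborel. \<Sigma> s \<omega> $ a $ b) + (LINT s:{s<..t}|lborel. \<Sigma> s \<omega> $ a $ b)"
      using st by (intro set_integral_Un set_integrable_subset[OF i]) auto
    finally have "V t \<omega> $ a $ b - V s \<omega> $ a $ b = (LINT s:{s<..t}|lborel. \<Sigma> s \<omega> $ a $ b)"
      using elim st by simp
    moreover have "(\<lambda>u. indicator {0<..1} u * (indicator {s<..t} u * \<Sigma> u \<omega> $ a $ b)) = (\<lambda>u. indicator {s<..t} u * \<Sigma> u \<omega> $ a $ b)"
      using st by (auto simp: indicator_def fun_eq_iff)
    ultimately show "(\<integral>u. indicator {s<..t} u * \<Sigma> u \<omega> $ a $ b \<partial>unit_time) = V t \<omega> $ a $ b - V s \<omega> $ a $ b"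
      by (simp add: integral_restrict_space set_lebesgue_integral_def)
  qed
qed

lemma V_measurable: "t \<in> {0..1} \<Longrightarrow> (\<lambda>\<omega>. V t \<omega> $ a $ b) \<in> borel_measurable Q"
  using qcov[of a b] measurable_path_sigma_Q[of "{0..t}" "\<lambda>\<omega>. V t \<omega> $ a $ b" borel]
  by (simp add: is_quadratic_covariation_def)

lemma prod_minus_V_martingale: "is_martingale Q (\<lambda>t \<omega>. \<omega> t $ a * \<omega> t $ b - V t \<omega> $ a $ b)"
  using qcov[of a b] by (simp add: is_quadratic_covariation_def)

text \<open>
  At time \<open>1\<close> this is square integrability of \<open>X\<close>.  Earlier times follow because the diagonal of \<open>V\<close>
  increases, as that of \<open>\<Sigma>\<close> is nonnegative.
\<close>

lemma integrable_V_diag: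
  assumes t: "t \<in> {0..1}" shows "integrable Q (\<lambda>\<omega>. V t \<omega> $ a $ a)"
proof (rule Bochner_Integration.integrable_bound)
  have "integrable Q (\<lambda>\<omega>. \<omega> 1 $ a * \<omega> 1 $ a - V 1 \<omega> $ a $ a)"
    using prod_minus_V_martingale[of a a] by (simp add: is_martingale_def)
  moreover have "integrable Q (\<lambda>\<omega>. \<omega> 1 $ a * \<omega> 1 $ a)"
    using mart by (simp add: canonical_square_integrable_martingale_def power2_eq_square)
  ultimately have "integrable Q (\<lambda>\<omega>. \<omega> 1 $ a * \<omega> 1 $ a - (\<omega> 1 $ a * \<omega> 1 $ a - V 1 \<omega> $ a $ a))"
    by (rule Bochner_Integration.integrable_diff[rotated])
  then show "integrable Q (\<lambda>\<omega>. V 1 \<omega> $ a $ a)" by simp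
  show "(\<lambda>\<omega>. V t \<omega> $ a $ a) \<in> borel_measurable Q" by (rule V_measurable[OF t])
  have sp: "AE \<omega> in Q. \<omega> \<in> paths" using space_Q by (metis AE_space)
  show "AE \<omega> in Q. norm (V t \<omega> $ a $ a) \<le> norm (V 1 \<omega> $ a $ a)"
    using covariance_density_entries covariance_increment sp
  proof eventually_elim
    case (elim \<omega>)
    have nn: "0 \<le> \<Sigma> u \<omega> $ a $ a" if "u \<in> {0..1}" for u
      using pos_semidef_diag_nonneg psd[OF that] elim by blast
    have "0 \<le> V t \<omega> $ a $ a"
    proof -
      have "0 \<le> (LINT u:{0..t}|lborel. \<Sigma> u \<omega> $ a $ a)"
        using t nn unfolding set_lebesgue_integral_def
        by (intro Bochner_Integration.integral_nonneg) (auto simp: indicator_def)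
      then show ?thesis using elim(1) t by simp
    qed
    moreover have "0 \<le> (\<integral>u. indicator {t<..1} u * \<Sigma> u \<omega> $ a $ a \<partial>unit_time)"
      using nn by (intro Bochner_Integration.integral_nonneg) (auto simp: space_restrict_space)
    then have "0 \<le> V 1 \<omega> $ a $ a - V t \<omega> $ a $ a" using elim(2) t by auto
    ultimately show ?case by simp
  qed
qed

text \<open>
  Square integrability at earlier times is obtained from \<open>V\<close>, since \<open>(X\<^sup>c)\<^sup>2 - V\<^sup>c\<^sup>c\<close> is integrable.
\<close>

lemma integrable_eval_prod:
  assumes s: "s \<in> {0..1}" and t: "t \<in> {0..1}" shows "integrable Q (\<lambda>\<omega>. \<omega> s $ a * \<omega> t $ b)"
proof -
  have sq: "integrable Q (\<lambda>\<omega>. (\<omega> u $ c)\<^sup>2)" if u: "u \<in> {0..1}" for u c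
  proof -
    have "integrable Q (\<lambda>\<omega>. \<omega> u $ c * \<omega> u $ c - V u \<omega> $ c $ c)"
      using prod_minus_V_martingale[of c c] u by (simp add: is_martingale_def)
    from Bochner_Integration.integrable_add[OF this integrable_V_diag[OF u, of c]] show ?thesis
      by (simp add: power2_eq_square)
  qed
  note [measurable] = eval_nth_measurable[OF s] eval_nth_measurable[OF t]
  show ?thesis
  proof (rule Bochner_Integration.integrable_bound)
    show "integrable Q (\<lambda>\<omega>. (\<omega> s $ a)\<^sup>2 + (\<omega> t $ b)\<^sup>2)" using sq s t by simp
    have "\<bar>x * y\<bar> \<le> x\<^sup>2 + y\<^sup>2" for x y :: real
      using sum_squares_bound[of "\<bar>x\<bar>" "\<bar>y\<bar>"] by (auto simp: abs_mult)
        (metis abs_ge_zero add.commute mult_nonneg_nonneg le_add_same_cancel1 order_trans mult_2 mult.assoc)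
    then show "AE \<omega> in Q. norm (\<omega> s $ a * \<omega> t $ b) \<le> norm ((\<omega> s $ a)\<^sup>2 + (\<omega> t $ b)\<^sup>2)" by simp
  qed measurable
qed

lemma integrable_V:
  assumes t: "t \<in> {0..1}" shows "integrable Q (\<lambda>\<omega>. V t \<omega> $ a $ b)"
proof -
  have "integrable Q (\<lambda>\<omega>. \<omega> t $ a * \<omega> t $ b - V t \<omega> $ a $ b)"
    using prod_minus_V_martingale[of a b] t by (simp add: is_martingale_def)
  from Bochner_Integration.integrable_diff[OF integrable_eval_prod[OF t t, of a b] this] show ?thesis by simp
qed

lemma integrable_indicator_times:
  assumes "A \<in> sets Q" "integrable Q f" shows "integrable Q (\<lambda>\<omega>. indicator A \<omega> * f \<omega> :: real)"
  using integrable_mult_indicator[OF assms] by simp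

text \<open>
  Expanding the product, the mixed terms \<open>X\<^sub>s X\<^sub>t\<close> turn into \<open>X\<^sub>s X\<^sub>s\<close> by the martingale property of \<open>X\<close>; what
  remains is the increment of \<open>X\<^sup>a X\<^sup>b\<close>, which has the same mean on \<open>A\<close> as that of \<open>V\<^sup>a\<^sup>b\<close>.
\<close>

lemma increment_product_integral:
  assumes st: "0 \<le> s" "s \<le> t" "t \<le> 1" and A: "A \<in> sets (path_filtration s)"
  shows "integrable Q (\<lambda>\<omega>. indicator A \<omega> * ((\<omega> t $ a - \<omega> s $ a) * (\<omega> t $ b - \<omega> s $ b)))" (is ?I)
    and "(\<integral>\<omega>. indicator A \<omega> * ((\<omega> t $ a - \<omega> s $ a) * (\<omega> t $ b - \<omega> s $ b)) \<partial>Q)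
      = (\<integral>\<omega>. indicator A \<omega> * (V t \<omega> $ a $ b - V s \<omega> $ a $ b) \<partial>Q)" (is ?E)
proof -
  have s': "s \<in> {0..1}" and t': "t \<in> {0..1}" using st by auto
  have AQ: "A \<in> sets Q" using A sets_path_sigma_Q[of "{0..s}"] st by auto
  note ip = integrable_indicator_times[OF AQ integrable_eval_prod]
  note iV = integrable_indicator_times[OF AQ integrable_V]
  have eq: "indicator A \<omega> * ((\<omega> t $ a - \<omega> s $ a) * (\<omega> t $ b - \<omega> s $ b))
     = indicator A \<omega> * (\<omega> t $ a * \<omega> t $ b) - indicator A \<omega> * (\<omega> s $ a * \<omega> t $ b)
       - indicator A \<omega> * (\<omega> s $ b * \<omega> t $ a) + indicator A \<omega> * (\<omega> s $ a * \<omega> s $ b)" for \<omega> :: "real \<Rightarrow> real ^ 'l"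
    by (simp add: algebra_simps)
  show ?I unfolding eq using ip s' t' by simp
  have X: "is_martingale Q (\<lambda>t \<omega>. \<omega> t $ i)" for i
    using mart by (simp add: canonical_square_integrable_martingale_def)
  have sm: "(\<lambda>\<omega>. indicator A \<omega> * \<omega> s $ i :: real) \<in> borel_measurable (path_filtration s)" for i
    using A st by (intro borel_measurable_times borel_measurable_indicator measurable_path_eval_nth) auto
  have cross: "(\<integral>\<omega>. indicator A \<omega> * (\<omega> s $ i * \<omega> t $ j) \<partial>Q) = (\<integral>\<omega>. indicator A \<omega> * (\<omega> s $ i * \<omega> s $ j) \<partial>Q)" for i j
    using martingale_integral_eq[OF X[of j] st sm[of i]] ip[OF s' t', of i j] by (simp add: mult.assoc)
  have "integrable Q (\<lambda>\<omega>. indicator A \<omega> * (\<omega> t $ a * \<omega> t $ b - V t \<omega> $ a $ b))"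
    using Bochner_Integration.integrable_diff[OF ip[OF t' t', of a b] iV[OF t', of a b]] by (simp add: right_diff_distrib)
  then have "(\<integral>\<omega>. indicator A \<omega> * (\<omega> t $ a * \<omega> t $ b - V t \<omega> $ a $ b) \<partial>Q)
    = (\<integral>\<omega>. indicator A \<omega> * (\<omega> s $ a * \<omega> s $ b - V s \<omega> $ a $ b) \<partial>Q)"
    using A by (intro martingale_integral_eq[OF prod_minus_V_martingale st]) auto
  then show ?E
    unfolding eq using ip s' t' iV cross[of a b] cross[of b a]
    by (simp add: right_diff_distrib mult.commute[of "_ s $ b"])
qed

end

section \<open>Integration over time and paths\<close>

lemma gauss_gain_affine:
  "\<exists>m. \<forall>S. gauss_gain T S = ln \<bar>det T\<bar> + (\<Sum>a\<in>UNIV. \<Sum>b\<in>UNIV. m a b * S $ a $ b)"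
  by (rule exI[of _ "\<lambda>a b. - 1/2 * ((transpose T ** T) $ a $ b - mat 1 $ a $ b)"])
    (simp add: gauss_gain_def sum_distrib_left sum_negf mult.assoc)

lemma measurable_gauss_gain_outer_square:
  fixes T :: "real ^ 'n ^ 'n::finite"
  shows "(\<lambda>x. gauss_gain T (c *\<^sub>R outer_square x)) \<in> borel_measurable borel"
proof -
  have [measurable]: "(\<lambda>x. T *v x) \<in> borel_measurable borel"
    by (intro borel_measurable_continuous_onI linear_continuous_on linear_conv_bounded_linear[THEN iffD1]) simp
  show ?thesis unfolding gauss_gain_outer_square by measurable
qed

context martingale_with_covariance_density
begin

sublocale time: finite_measure unit_time
  by (rule finite_measureI) (simp add: emeasure_restrict_space space_restrict_space)

sublocale time_path: pair_sigma_finite unit_time Q ..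

lemma finite_measure_time_path: "finite_measure time_path"
proof (rule finite_measureI)
  show "emeasure time_path (space time_path) \<noteq> \<infinity>"
  proof -
    have "emeasure time_path (space time_path) = emeasure unit_time (space unit_time) * emeasure Q (space Q)"
      unfolding space_pair_measure by (rule emeasure_pair_measure_Times) (rule sets.top)+
    then show ?thesis 
      by (metis emeasure_space_1 mult.right_neutral time.emeasure_finite infinity_ennreal_def)
  qed
qed

lemma space_time_path: "space time_path = {0<..1} \<times> paths"
  by (simp add: space_pair_measure space_restrict_space space_Q)

lemma sets_grid_predictable_time_path: "sets (grid_predictable n) \<subseteq> sets time_path"
  unfolding sets_grid_predictable space_time_path[symmetric]
proof (rule sets.sigma_sets_subset, safe)
  fix p q and U :: "(real ^ 'l) set" assume pq: "p \<in> dyadic_grid n" "q \<in> dyadic_grid n" "p \<le> q" "U \<in> sets borel"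
  then have p: "0 \<le> q" "p \<in> {0..1}" by (auto simp: dyadic_grid_def)
  have "{\<omega> \<in> paths. \<omega> p \<in> U} \<in> sets Q"
    using measurable_sets[OF eval_measurable[OF p(2)] pq(4)] by (simp add: space_Q vimage_def Int_def conj_commute)
  moreover have "{q<..1} \<in> sets unit_time"
    using p by (auto simp: sets_restrict_space_iff)
  ultimately show "{q<..1} \<times> {\<omega> \<in> paths. \<omega> p \<in> U} \<in> sets time_path" by (rule pair_measureI[rotated])
qed

lemma sets_predictable_time_path:
  assumes "E \<in> sets predictable_sigma" shows "E \<inter> space time_path \<in> sets time_path"
proof -
  have "sigma_sets (space time_path) (\<Union>n. sets (grid_predictable n)) \<subseteq> sets time_path"
    using sets_grid_predictable_time_path by (intro sets.sigma_sets_subset) auto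
  then show ?thesis using predictable_generated_by_grid[OF assms] by (auto simp: space_time_path)
qed

lemma space_predictable_sigma: "space (predictable_sigma :: (real \<times> (real \<Rightarrow> real ^ 'l)) measure) = {0..1} \<times> paths"
  unfolding predictable_sigma_def
proof (rule space_measure_of)
  have "A \<subseteq> paths" if "A \<in> sets (path_filtration s)" for A :: "(real \<Rightarrow> real ^ 'l) set" and s
    using sets.sets_into_space[OF that] by simp
  then show "{{0} \<times> A |A. A \<in> sets (path_filtration 0)} \<union>
      {{s<..t} \<times> A |s t A. 0 \<le> s \<and> s < t \<and> t \<le> 1 \<and> A \<in> sets (path_filtration s)} \<subseteq> Pow ({0..1} \<times> (paths :: (real \<Rightarrow> real ^ 'l) set))"
    by fastforce
qed

lemma predictable_measurable_time_path:
  assumes "g \<in> measurable predictable_sigma N" shows "g \<in> measurable time_path N"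
proof (rule measurableI)
  fix x assume "x \<in> space time_path"
  then show "g x \<in> space N"
    using measurable_space[OF assms, of x] by (auto simp: space_predictable_sigma space_time_path)
next
  fix A assume "A \<in> sets N"
  have "g -` A \<inter> space time_path = (g -` A \<inter> space predictable_sigma) \<inter> space time_path"
    by (auto simp: space_predictable_sigma space_time_path)
  also have "\<dots> \<in> sets time_path"
    by (intro sets_predictable_time_path measurable_sets[OF assms] \<open>A \<in> sets N\<close>)
  finally show "g -` A \<inter> space time_path \<in> sets time_path" .
qed

abbreviation "\<Sigma>' x \<equiv> \<Sigma> (fst x) (snd x)"

lemma predictable_density: "\<Sigma>' \<in> borel_measurable predictable_sigma"
  using pred by (simp add: case_prod_beta')

lemma predictable_density_entry: "(\<lambda>x. \<Sigma>' x $ a $ b) \<in> borel_measurable predictable_sigma"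
proof -
  have "(\<lambda>S :: real ^ 'l ^ 'l. S $ a $ b) \<in> borel_measurable borel"
    by (intro borel_measurable_continuous_onI continuous_intros)
  then show ?thesis by (rule measurable_compose[OF predictable_density])
qed

lemmas density_entry_measurable = predictable_measurable_time_path[OF predictable_density_entry]

lemma psd_time_path: "x \<in> space time_path \<Longrightarrow> pos_semidef (\<Sigma>' x)"
  using psd by (auto simp: space_time_path)

text \<open>
  The integral of \<open>\<Sigma>\<^sup>a\<^sup>a\<close> over time is the increment of \<open>V\<^sup>a\<^sup>a\<close>, which is integrable.
\<close>

lemma integrable_density_diag: "integrable time_path (\<lambda>x. \<Sigma>' x $ a $ a)"
proof (rule integrableI_nonneg)
  show "(\<lambda>x. \<Sigma>' x $ a $ a) \<in> borel_measurable time_path" by (rule density_entry_measurable)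
  show "AE x in time_path. 0 \<le> \<Sigma>' x $ a $ a"
    by (intro AE_I2 pos_semidef_diag_nonneg psd_time_path)
  have sp: "AE \<omega> in Q. \<omega> \<in> paths" using space_Q by (metis AE_space)
  have "(\<integral>\<^sup>+x. ennreal (\<Sigma>' x $ a $ a) \<partial>time_path) = (\<integral>\<^sup>+\<omega>. \<integral>\<^sup>+u. ennreal (\<Sigma> u \<omega> $ a $ a) \<partial>unit_time \<partial>Q)"
    using density_entry_measurable[of a a] by (subst time_path.nn_integral_snd[symmetric]) auto
  also have "\<dots> = (\<integral>\<^sup>+\<omega>. ennreal (V 1 \<omega> $ a $ a - V 0 \<omega> $ a $ a) \<partial>Q)"
  proof (rule nn_integral_cong_AE)
    show "AE \<omega> in Q. (\<integral>\<^sup>+u. ennreal (\<Sigma> u \<omega> $ a $ a) \<partial>unit_time) = ennreal (V 1 \<omega> $ a $ a - V 0 \<omega> $ a $ a)"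
      using covariance_increment sp
    proof eventually_elim
      case (elim \<omega>)
      have "(\<integral>\<^sup>+u. ennreal (\<Sigma> u \<omega> $ a $ a) \<partial>unit_time) = ennreal (\<integral>u. \<Sigma> u \<omega> $ a $ a \<partial>unit_time)"
        using elim by (intro nn_integral_eq_integral AE_I2 pos_semidef_diag_nonneg psd) (auto simp: space_restrict_space)
      also have "(\<integral>u. \<Sigma> u \<omega> $ a $ a \<partial>unit_time) = (\<integral>u. indicator {0<..1} u * \<Sigma> u \<omega> $ a $ a \<partial>unit_time)"
        by (intro Bochner_Integration.integral_cong) (auto simp: space_restrict_space)
      also have "\<dots> = V 1 \<omega> $ a $ a - V 0 \<omega> $ a $ a"
        using elim(1)[rule_format, THEN conjunct2, rule_format, of 0 1 a a] by simp
      finally show ?case .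
    qed
  qed
  also have "\<dots> < \<infinity>"
  proof -
    have "integrable Q (\<lambda>\<omega>. V 1 \<omega> $ a $ a - V 0 \<omega> $ a $ a)"
      by (intro Bochner_Integration.integrable_diff integrable_V) auto
    from nn_integral_mono[of Q "\<lambda>\<omega>. ennreal (V 1 \<omega> $ a $ a - V 0 \<omega> $ a $ a)" "\<lambda>\<omega>. ennreal (norm (V 1 \<omega> $ a $ a - V 0 \<omega> $ a $ a))"]
      this show ?thesis
      unfolding integrable_iff_bounded by (auto intro: ennreal_leI le_less_trans simp: abs_ge_self)
  qed
  finally show "(\<integral>\<^sup>+x. ennreal (\<Sigma>' x $ a $ a) \<partial>time_path) < \<infinity>" .
qed

lemma integrable_density_trace: "integrable time_path (\<lambda>x. trace (\<Sigma>' x))"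
  unfolding trace_def by (intro Bochner_Integration.integrable_sum integrable_density_diag)

lemma integrable_density_entry: "integrable time_path (\<lambda>x. \<Sigma>' x $ a $ b)"
proof (rule Bochner_Integration.integrable_bound[OF integrable_density_trace density_entry_measurable])
  show "AE x in time_path. norm (\<Sigma>' x $ a $ b) \<le> norm (trace (\<Sigma>' x))"
    unfolding real_norm_def
    by (intro AE_I2 order_trans[OF pos_semidef_entry_le_trace[OF psd_time_path] abs_ge_self])
qed

lemma slab_sets: "0 \<le> s \<Longrightarrow> t \<le> 1 \<Longrightarrow> A \<in> sets Q \<Longrightarrow> {s<..t} \<times> A \<in> sets time_path"
  by (intro pair_measureI) (auto simp: sets_restrict_space_iff)

lemma slab_integral:
  assumes st: "0 \<le> s" "s \<le> t" "t \<le> 1" and A: "A \<in> sets Q"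
  shows "(\<integral>x. indicator ({s<..t} \<times> A) x * \<Sigma>' x $ a $ b \<partial>time_path)
    = (\<integral>\<omega>. indicator A \<omega> * (V t \<omega> $ a $ b - V s \<omega> $ a $ b) \<partial>Q)"
proof -
  define f where "f u \<omega> = indicator ({s<..t} \<times> A) (u, \<omega>) * \<Sigma> u \<omega> $ a $ b" for u \<omega>
  have f: "case_prod f = (\<lambda>x. indicator ({s<..t} \<times> A) x * \<Sigma>' x $ a $ b)"
    by (auto simp: f_def fun_eq_iff)
  have "integrable time_path (case_prod f)"
    unfolding f using integrable_mult_indicator[OF slab_sets[OF st(1,3) A] integrable_density_entry] by simp
  then have "(\<integral>x. case_prod f x \<partial>time_path) = (\<integral>\<omega>. \<integral>u. f u \<omega> \<partial>unit_time \<partial>Q)"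
    by (rule time_path.integral_snd[symmetric])
  also have "\<dots> = (\<integral>\<omega>. indicator A \<omega> * (V t \<omega> $ a $ b - V s \<omega> $ a $ b) \<partial>Q)"
  proof (rule integral_cong_AE)
    show "(\<lambda>\<omega>. \<integral>u. f u \<omega> \<partial>unit_time) \<in> borel_measurable Q"
      using \<open>integrable time_path (case_prod f)\<close> by (intro borel_measurable_integrable time_path.integrable_snd)
    show "(\<lambda>\<omega>. indicator A \<omega> * (V t \<omega> $ a $ b - V s \<omega> $ a $ b)) \<in> borel_measurable Q"
      using A st by (intro borel_measurable_times borel_measurable_diff V_measurable) auto
    show "AE \<omega> in Q. (\<integral>u. f u \<omega> \<partial>unit_time) = indicator A \<omega> * (V t \<omega> $ a $ b - V s \<omega> $ a $ b)"
      using covariance_increment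
    proof eventually_elim
      case (elim \<omega>)
      have "f u \<omega> = indicator A \<omega> * (indicator {s<..t} u * \<Sigma> u \<omega> $ a $ b)" for u
        by (simp add: f_def indicator_times mult_ac)
      then have "(\<integral>u. f u \<omega> \<partial>unit_time) = indicator A \<omega> * (\<integral>u. indicator {s<..t} u * \<Sigma> u \<omega> $ a $ b \<partial>unit_time)"
        by simp
      then show ?case
        using elim[rule_format, THEN conjunct2, rule_format, of s t a b] st by simp
    qed
  qed
  finally show ?thesis unfolding f .
qed

lemma integrable_gain_density: "integrable time_path (\<lambda>x. gauss_gain T (\<Sigma>' x))"
proof -
  interpret tp: finite_measure time_path by (rule finite_measure_time_path)
  obtain m where "\<And>S. gauss_gain T S = ln \<bar>det T\<bar> + (\<Sum>a\<in>UNIV. \<Sum>b\<in>UNIV. m a b * S $ a $ b)"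
    using gauss_gain_affine by blast
  then show ?thesis using integrable_density_entry by simp
qed

text \<open>
  The gain is affine in the matrix, and entry by entry the products of increments may be exchanged
  for integrals of \<open>\<Sigma>\<close>.  The constant term matches because the slab has measure \<open>(t - s) Q(A)\<close>.
\<close>

lemma gain_increment:
  assumes st: "0 \<le> s" "s < t" "t \<le> 1" and A: "A \<in> sets (path_filtration s)"
  defines "c \<equiv> 1 / (t - s)"
  shows "integrable Q (\<lambda>\<omega>. indicator A \<omega> * gauss_gain T (c *\<^sub>R outer_square (\<omega> t - \<omega> s)))" (is ?I)
    and "integrable time_path (\<lambda>x. indicator ({s<..t} \<times> A) x * gauss_gain T (\<Sigma>' x))" (is ?J)
    and "(\<integral>\<omega>. indicator A \<omega> * gauss_gain T (c *\<^sub>R outer_square (\<omega> t - \<omega> s)) \<partial>Q)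
      = c * (\<integral>x. indicator ({s<..t} \<times> A) x * gauss_gain T (\<Sigma>' x) \<partial>time_path)" (is ?E)
proof -
  interpret tp: finite_measure time_path by (rule finite_measure_time_path)
  have AQ: "A \<in> sets Q" using A sets_path_sigma_Q[of "{0..s}"] st by auto
  have SA: "{s<..t} \<times> A \<in> sets time_path" using slab_sets st AQ by auto
  obtain m where m: "\<And>S. gauss_gain T S = ln \<bar>det T\<bar> + (\<Sum>a\<in>UNIV. \<Sum>b\<in>UNIV. m a b * S $ a $ b)"
    using gauss_gain_affine by blast
  define K where "K = ln \<bar>det T\<bar>"
  have st': "s \<le> t" using st by simp
  note inc = increment_product_integral[OF st(1) st' st(3) A]
  have eq1: "indicator A \<omega> * gauss_gain T (c *\<^sub>R outer_square (\<omega> t - \<omega> s))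
    = K * indicator A \<omega> + (\<Sum>a\<in>UNIV. \<Sum>b\<in>UNIV. (m a b * c) * (indicator A \<omega> * ((\<omega> t $ a - \<omega> s $ a) * (\<omega> t $ b - \<omega> s $ b))))" for \<omega>
    by (simp add: m K_def outer_square_def distrib_left sum_distrib_left mult_ac)
  have eq2: "indicator ({s<..t} \<times> A) x * gauss_gain T (\<Sigma>' x)
    = K * indicator ({s<..t} \<times> A) x + (\<Sum>a\<in>UNIV. \<Sum>b\<in>UNIV. m a b * (indicator ({s<..t} \<times> A) x * \<Sigma>' x $ a $ b))" for x
    by (simp add: m K_def distrib_left sum_distrib_left mult_ac)
  have i1: "integrable Q (\<lambda>\<omega>. K * indicator A \<omega>)" using AQ by (auto simp: emeasure_eq_measure)
  have i2: "integrable time_path (\<lambda>x. K * indicator ({s<..t} \<times> A) x)"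
    using SA by (auto simp: tp.emeasure_eq_measure)
  have i3: "integrable time_path (\<lambda>x. indicator ({s<..t} \<times> A) x * \<Sigma>' x $ a $ b)" for a b
    using integrable_mult_indicator[OF SA integrable_density_entry] by simp
  show ?I unfolding eq1 using i1 inc(1) by (intro Bochner_Integration.integrable_add Bochner_Integration.integrable_sum integrable_mult_right) auto
  show ?J unfolding eq2 using i2 i3 by (intro Bochner_Integration.integrable_add Bochner_Integration.integrable_sum integrable_mult_right) auto
  have ms: "measure time_path ({s<..t} \<times> A) = (t - s) * measure Q A"
  proof -
    have "emeasure time_path ({s<..t} \<times> A) = emeasure unit_time {s<..t} * emeasure Q A"
      using st AQ by (intro emeasure_pair_measure_Times) (auto simp: sets_restrict_space_iff)
    also have "emeasure unit_time {s<..t} = ennreal (t - s)"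
      using st by (subst emeasure_restrict_space) auto
    finally show ?thesis
      using st by (simp add: measure_def enn2real_mult)
  qed
  have "(\<integral>\<omega>. indicator A \<omega> * gauss_gain T (c *\<^sub>R outer_square (\<omega> t - \<omega> s)) \<partial>Q)
    = K * measure Q A + (\<Sum>a\<in>UNIV. \<Sum>b\<in>UNIV. (m a b * c) * (\<integral>\<omega>. indicator A \<omega> * (V t \<omega> $ a $ b - V s \<omega> $ a $ b) \<partial>Q))"
  proof -
    have "(\<integral>\<omega>. indicator A \<omega> * gauss_gain T (c *\<^sub>R outer_square (\<omega> t - \<omega> s)) \<partial>Q)
    = (\<integral>\<omega>. K * indicator A \<omega> \<partial>Q) + (\<Sum>a\<in>UNIV. \<Sum>b\<in>UNIV. (m a b * c) * (\<integral>\<omega>. indicator A \<omega> * ((\<omega> t $ a - \<omega> s $ a) * (\<omega> t $ b - \<omega> s $ b)) \<partial>Q))"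
      unfolding eq1 using i1 inc(1)
      by (subst Bochner_Integration.integral_add, simp, simp, subst Bochner_Integration.integral_sum, simp)
        (simp add: Bochner_Integration.integral_sum)
    then show ?thesis unfolding inc(2) using AQ sets.sets_into_space[OF AQ] by (simp add: Int_absorb2)
  qed
  also have "\<dots> = c * (K * measure time_path ({s<..t} \<times> A) + (\<Sum>a\<in>UNIV. \<Sum>b\<in>UNIV. m a b * (\<integral>x. indicator ({s<..t} \<times> A) x * \<Sigma>' x $ a $ b \<partial>time_path)))"
    unfolding ms slab_integral[OF st(1) st' st(3) AQ] using st
    by (simp add: distrib_left sum_distrib_left mult_ac c_def)
  also have "K * measure time_path ({s<..t} \<times> A) + (\<Sum>a\<in>UNIV. \<Sum>b\<in>UNIV. m a b * (\<integral>x. indicator ({s<..t} \<times> A) x * \<Sigma>' x $ a $ b \<partial>time_path))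
     = (\<integral>x. indicator ({s<..t} \<times> A) x * gauss_gain T (\<Sigma>' x) \<partial>time_path)"
  proof -
    have "(\<integral>x. indicator ({s<..t} \<times> A) x * gauss_gain T (\<Sigma>' x) \<partial>time_path)
     = (\<integral>x. K * indicator ({s<..t} \<times> A) x \<partial>time_path) + (\<Sum>a\<in>UNIV. \<Sum>b\<in>UNIV. m a b * (\<integral>x. indicator ({s<..t} \<times> A) x * \<Sigma>' x $ a $ b \<partial>time_path))"
      unfolding eq2 using i2 i3
      by (subst Bochner_Integration.integral_add, simp, simp, subst Bochner_Integration.integral_sum, simp)
        (simp add: Bochner_Integration.integral_sum)
    then show ?thesis using SA sets.sets_into_space[OF SA] by (simp add: Int_absorb2)
  qed
  finally show ?E .
qed

end

section \<open>The entropy bound on a dyadic grid\<close>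

lemma integral_double_sum:
  fixes f :: "'i \<Rightarrow> 'j \<Rightarrow> 'a \<Rightarrow> real"
  assumes "\<And>k i. k \<in> K \<Longrightarrow> i \<in> I \<Longrightarrow> integrable M (f k i)"
  shows "integrable M (\<lambda>x. \<Sum>k\<in>K. \<Sum>i\<in>I. f k i x)"
    and "(\<integral>x. (\<Sum>k\<in>K. \<Sum>i\<in>I. f k i x) \<partial>M) = (\<Sum>k\<in>K. \<Sum>i\<in>I. \<integral>x. f k i x \<partial>M)"
  using assms by (simp_all add: Bochner_Integration.integral_sum)

context martingale_with_covariance_density
begin

text \<open>
  The log-likelihood ratio of the increment in step \<open>k\<close>, scaled by \<open>2\<^sup>n\<close> to unit variance under Wiener
  measure.  A grid-predictable \<open>J\<close> is constant on the step, so evaluating it at the right end uses only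
  the path up to the left end.
\<close>

definition grid_gain :: "nat \<Rightarrow> (nat \<Rightarrow> real ^ 'l ^ 'l) \<Rightarrow> (real \<times> (real \<Rightarrow> real ^ 'l) \<Rightarrow> nat) \<Rightarrow> nat \<Rightarrow> (real \<Rightarrow> real ^ 'l) \<Rightarrow> real" where
  "grid_gain n T J k \<omega> = gauss_gain (T (J (real (Suc k) / 2 ^ n, \<omega>)))
     (2 ^ n *\<^sub>R outer_square (\<omega> (real (Suc k) / 2 ^ n) - \<omega> (real k / 2 ^ n)))"

context
  fixes n :: nat and T :: "nat \<Rightarrow> real ^ 'l ^ 'l" and J :: "real \<times> (real \<Rightarrow> real ^ 'l) \<Rightarrow> nat" and r :: nat
  assumes J: "J \<in> measurable (grid_predictable n) (count_space UNIV)" and Jr: "\<And>x. J x \<le> r"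
    and T: "\<And>i. det (T i) \<noteq> 0"
begin

abbreviation (input) "\<tau> k \<equiv> real k / 2 ^ n"

definition "chosen_paths k i = {\<omega> \<in> paths. J (real (Suc k) / 2 ^ n, \<omega>) = i}"

lemma grid_point: assumes "k \<le> 2 ^ n" shows "0 \<le> \<tau> k" "\<tau> k \<le> 1" "\<tau> k \<in> {0..1}"
proof -
  have "real k \<le> 2 ^ n" using assms by (metis of_nat_le_iff of_nat_numeral of_nat_power)
  then show "0 \<le> \<tau> k" "\<tau> k \<le> 1" "\<tau> k \<in> {0..1}" by auto
qed

lemma grid_step: "\<tau> k < \<tau> (Suc k)" "1 / (\<tau> (Suc k) - \<tau> k) = 2 ^ n"
  by (simp_all add: divide_less_cancel diff_divide_distrib[symmetric] del: of_nat_Suc) simp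

lemma chosen_paths_grid:
  assumes k: "k < 2 ^ n"
  shows "chosen_paths k i \<in> sets (path_sigma {real j / 2 ^ n |j. j \<le> k})"
    and "t \<in> {\<tau> k<..\<tau> (Suc k)} \<Longrightarrow> \<omega> \<in> paths \<Longrightarrow> J (t, \<omega>) = J (\<tau> (Suc k), \<omega>)"
proof -
  have in01: "t \<in> {0<..1}" if "t \<in> {\<tau> k<..\<tau> (Suc k)}" for t
  proof -
    have "0 \<le> \<tau> k" "\<tau> (Suc k) \<le> 1" using grid_point[of k] grid_point[of "Suc k"] k by auto
    then show ?thesis using that by (meson greaterThanAtMost_iff order_trans le_less_trans)
  qed
  have end_mem: "\<tau> (Suc k) \<in> {\<tau> k<..\<tau> (Suc k)}" using grid_step(1) by (simp del: of_nat_Suc)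
  have E: "J -` {i} \<inter> ({0<..1} \<times> paths) \<in> sets (grid_predictable n)" for i
    using measurable_sets[OF J, of "{i}"] by simp
  note sec = grid_predictable_section[OF E k]
  have "chosen_paths k i = {\<omega> \<in> paths. (\<tau> (Suc k), \<omega>) \<in> J -` {i} \<inter> ({0<..1} \<times> paths)}"
    using in01[OF end_mem] by (auto simp: chosen_paths_def simp del: of_nat_Suc)
  then show "chosen_paths k i \<in> sets (path_sigma {real j / 2 ^ n |j. j \<le> k})" using sec by simp
  show "J (t, \<omega>) = J (\<tau> (Suc k), \<omega>)" if t: "t \<in> {\<tau> k<..\<tau> (Suc k)}" and w: "\<omega> \<in> paths"
    using sec[THEN conjunct2, rule_format, OF t w, of "J (t, \<omega>)"] in01[OF t] w by simp
qed

lemma chosen_paths_filtration: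
  assumes k: "k < 2 ^ n" shows "chosen_paths k i \<in> sets (path_filtration (\<tau> k))"
proof -
  have "{real j / 2 ^ n |j. j \<le> k} \<subseteq> {0..\<tau> k}" by (auto simp: divide_le_cancel)
  then show ?thesis using chosen_paths_grid(1)[OF k] path_sigma_mono by blast
qed

text \<open>
  Splitting according to the value of \<open>J\<close> reduces statements about \<open>T\<^sub>J\<close> to a fixed matrix on an event
  of the past.
\<close>

lemma sum_chosen_paths:
  assumes "\<omega> \<in> paths"
  shows "(\<Sum>i\<le>r. indicator (chosen_paths k i) \<omega> * g i) = (g (J (\<tau> (Suc k), \<omega>)) :: 'b::semiring_1)"
proof -
  have "(\<Sum>i\<le>r. indicator (chosen_paths k i) \<omega> * g i) = (\<Sum>i\<le>r. if i = J (\<tau> (Suc k), \<omega>) then g i else 0)"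
    using assms by (intro sum.cong) (auto simp: chosen_paths_def indicator_def simp del: of_nat_Suc)
  then show ?thesis using Jr by simp
qed

lemma grid_gain_sum:
  assumes "\<omega> \<in> paths"
  shows "grid_gain n T J k \<omega> = (\<Sum>i\<le>r. indicator (chosen_paths k i) \<omega> *
    gauss_gain (T i) (2 ^ n *\<^sub>R outer_square (\<omega> (\<tau> (Suc k)) - \<omega> (\<tau> k))))"
  unfolding sum_chosen_paths[OF assms] grid_gain_def ..

lemma grid_gain_measurable:
  assumes k: "k < 2 ^ n" and S: "{real j / 2 ^ n |j. j \<le> Suc k} \<subseteq> S"
  shows "grid_gain n T J k \<in> borel_measurable (path_sigma S)"
proof -
  have c[measurable]: "chosen_paths k i \<in> sets (path_sigma S)" for i
  proof -
    have "{real j / 2 ^ n |j. j \<le> k} \<subseteq> S" using S by force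
    then show ?thesis using chosen_paths_grid(1)[OF k] path_sigma_mono by blast
  qed
  have [measurable]: "(\<lambda>\<omega>. \<omega> (\<tau> (Suc k)) - \<omega> (\<tau> k)) \<in> borel_measurable (path_sigma S)"
    using S by (intro borel_measurable_diff measurable_path_eval) (auto intro: exI[of _ k] exI[of _ "Suc k"] simp del: of_nat_Suc)
  have g: "(\<lambda>\<omega>. gauss_gain (T i) (2 ^ n *\<^sub>R outer_square (\<omega> (\<tau> (Suc k)) - \<omega> (\<tau> k)))) \<in> borel_measurable (path_sigma S)" for i
    by (rule measurable_compose[OF _ measurable_gauss_gain_outer_square]) measurable
  have "(\<lambda>\<omega>. \<Sum>i\<le>r. indicator (chosen_paths k i) \<omega> *
    gauss_gain (T i) (2 ^ n *\<^sub>R outer_square (\<omega> (\<tau> (Suc k)) - \<omega> (\<tau> k)))) \<in> borel_measurable (path_sigma S)"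
    using g c by (intro borel_measurable_sum borel_measurable_times borel_measurable_indicator) auto
  then show ?thesis
    by (rule measurable_cong[THEN iffD2, rotated]) (simp add: grid_gain_sum)
qed

text \<open>
  Integrate out the last step first; the earlier factors are measurable with respect to its past.
\<close>

lemma exp_grid_gain_wiener:
  fixes B :: "(real \<Rightarrow> real ^ 'l) measure"
  assumes B: "is_wiener_measure B" and m: "m \<le> 2 ^ n"
  shows "(\<integral>\<^sup>+\<omega>. (\<Prod>k<m. ennreal (exp (grid_gain n T J k \<omega>))) \<partial>B) = 1"
  using m
proof (induction m)
  case 0
  interpret B: prob_space B using B by (simp add: is_wiener_measure_def is_path_law_def)
  show ?case by (simp add: B.emeasure_space_1)
next
  case (Suc m)
  have sB: "sets B = sets (path_filtration 1)"
    using B by (simp add: is_wiener_measure_def is_path_law_def)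
  have spB: "space B = paths" using sets_eq_imp_space_eq[OF sB] by simp
  have mB: "f \<in> borel_measurable (path_filtration s) \<Longrightarrow> s \<le> 1 \<Longrightarrow> f \<in> borel_measurable B" for f :: "_ \<Rightarrow> ennreal" and s
    using path_sigma_mono[of "{0..s}" "{0..1}"] sB spB by (auto simp: measurable_def)
  have m: "m < 2 ^ n" using Suc.prems by simp
  define Y where "Y \<omega> = (\<Prod>k<m. ennreal (exp (grid_gain n T J k \<omega>)))" for \<omega>
  have Y: "Y \<in> borel_measurable (path_filtration (\<tau> m))"
    unfolding Y_def
  proof (intro borel_measurable_prod_ennreal measurable_compose[OF _ measurable_ennreal] measurable_compose[OF _ borel_measurable_exp] grid_gain_measurable)
    fix k assume "k \<in> {..<m}"
    then show "k < 2 ^ n" "{real j / 2 ^ n |j. j \<le> Suc k} \<subseteq> {0..\<tau> m}"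
      using m by (auto intro!: divide_right_mono simp del: of_nat_Suc)
  qed
  have s01: "0 \<le> \<tau> m" "\<tau> (Suc m) \<le> 1" using grid_point[of m] grid_point[of "Suc m"] Suc.prems by auto
  have mle: "\<tau> m \<le> 1" using grid_point[of m] m by auto
  let ?g = "\<lambda>i \<omega>. ennreal (exp (gauss_gain (T i) (2 ^ n *\<^sub>R outer_square (\<omega> (\<tau> (Suc m)) - \<omega> (\<tau> m)))))"
  have Yi: "(\<lambda>\<omega>. Y \<omega> * indicator (chosen_paths m i) \<omega>) \<in> borel_measurable (path_filtration (\<tau> m))" for i
    using Y chosen_paths_filtration[OF m] by (intro borel_measurable_times_ennreal borel_measurable_indicator) auto
  have step: "(\<integral>\<^sup>+\<omega>. (Y \<omega> * indicator (chosen_paths m i) \<omega>) * ?g i \<omega> \<partial>B) = (\<integral>\<^sup>+\<omega>. Y \<omega> * indicator (chosen_paths m i) \<omega> \<partial>B)" for i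
    using wiener_measure_gauss_step[OF B s01(1) grid_step(1) s01(2) Yi T, of i i] unfolding grid_step(2) .
  have gm: "?g i \<in> borel_measurable (path_filtration 1)" for i
    using s01 grid_point[of "Suc m"] Suc.prems grid_point(3)[of m] m
    by (intro measurable_compose[OF _ measurable_ennreal] measurable_compose[OF _ borel_measurable_exp]
       measurable_compose[OF _ measurable_gauss_gain_outer_square] borel_measurable_diff measurable_path_eval) (auto simp del: of_nat_Suc)
  have "(\<integral>\<^sup>+\<omega>. (\<Prod>k<Suc m. ennreal (exp (grid_gain n T J k \<omega>))) \<partial>B)
    = (\<integral>\<^sup>+\<omega>. (\<Sum>i\<le>r. (Y \<omega> * indicator (chosen_paths m i) \<omega>) * ?g i \<omega>) \<partial>B)"
  proof (rule nn_integral_cong)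
    fix \<omega> assume "\<omega> \<in> space B"
    then have w: "\<omega> \<in> paths" by (simp add: spB)
    have "(\<Sum>i\<le>r. (Y \<omega> * indicator (chosen_paths m i) \<omega>) * ?g i \<omega>) = Y \<omega> * (\<Sum>i\<le>r. indicator (chosen_paths m i) \<omega> * ?g i \<omega>)"
      by (simp only: sum_distrib_left mult.assoc)
    also have "\<dots> = Y \<omega> * ?g (J (\<tau> (Suc m), \<omega>)) \<omega>"
      unfolding sum_chosen_paths[OF w, of m "\<lambda>i. ?g i \<omega>"] ..
    finally show "(\<Prod>k<Suc m. ennreal (exp (grid_gain n T J k \<omega>))) = (\<Sum>i\<le>r. (Y \<omega> * indicator (chosen_paths m i) \<omega>) * ?g i \<omega>)"
      by (simp only: prod.lessThan_Suc Y_def grid_gain_def)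
  qed
  also have "\<dots> = (\<Sum>i\<le>r. \<integral>\<^sup>+\<omega>. (Y \<omega> * indicator (chosen_paths m i) \<omega>) * ?g i \<omega> \<partial>B)"
    by (intro nn_integral_sum borel_measurable_times_ennreal[OF mB[OF Yi mle] mB[OF gm order_refl]])
  also have "\<dots> = (\<Sum>i\<le>r. \<integral>\<^sup>+\<omega>. Y \<omega> * indicator (chosen_paths m i) \<omega> \<partial>B)" unfolding step ..
  also have "\<dots> = (\<integral>\<^sup>+\<omega>. (\<Sum>i\<le>r. Y \<omega> * indicator (chosen_paths m i) \<omega>) \<partial>B)"
    by (intro nn_integral_sum[symmetric] mB[OF Yi mle])
  also have "\<dots> = (\<integral>\<^sup>+\<omega>. Y \<omega> \<partial>B)"
  proof (rule nn_integral_cong)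
    fix \<omega> assume "\<omega> \<in> space B"
    then have w: "\<omega> \<in> paths" by (simp add: spB)
    show "(\<Sum>i\<le>r. Y \<omega> * indicator (chosen_paths m i) \<omega>) = Y \<omega>"
      using sum_chosen_paths[OF w, of m "\<lambda>_. 1 :: ennreal"] by (simp add: sum_distrib_left[symmetric])
  qed
  also have "\<dots> = 1" using Suc by (simp add: Y_def)
  finally show ?case .
qed

lemma sum_grid_indicator: "(\<Sum>k<m. indicator {\<tau> k<..\<tau> (Suc k)} t) = (indicator {0<..\<tau> m} t :: real)"
proof (induction m)
  case (Suc m)
  have "\<tau> m \<le> \<tau> (Suc m)" "0 \<le> \<tau> m" using grid_step(1)[of m] by auto
  moreover have "0 < t" if "\<tau> m < t" using that \<open>0 \<le> \<tau> m\<close> by linarith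
  ultimately show ?case using Suc by (auto simp: indicator_def simp del: of_nat_Suc)
qed simp

text \<open>
  The slabs \<open>(k/2\<^sup>n, (k+1)/2\<^sup>n] \<times> {J = i}\<close> partition time and path space, and on each of them the matrix
  is fixed.
\<close>

lemma grid_gain_integral:
  shows "integrable Q (\<lambda>\<omega>. \<Sum>k<2 ^ n. grid_gain n T J k \<omega>)"
    and "(\<integral>\<omega>. (\<Sum>k<2 ^ n. grid_gain n T J k \<omega>) \<partial>Q) = 2 ^ n * (\<integral>x. gauss_gain (T (J x)) (\<Sigma>' x) \<partial>time_path)"
proof -
  let ?g = "\<lambda>k i \<omega>. indicator (chosen_paths k i) \<omega> * gauss_gain (T i) (2 ^ n *\<^sub>R outer_square (\<omega> (\<tau> (Suc k)) - \<omega> (\<tau> k)))"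
  let ?h = "\<lambda>k i x. indicator ({\<tau> k<..\<tau> (Suc k)} \<times> chosen_paths k i) x * gauss_gain (T i) (\<Sigma>' x)"
  have gi: "integrable Q (?g k i)" "integrable time_path (?h k i)"
    "(\<integral>\<omega>. ?g k i \<omega> \<partial>Q) = 2 ^ n * (\<integral>x. ?h k i x \<partial>time_path)" if k: "k < 2 ^ n" for k i
  proof -
    have s01: "0 \<le> \<tau> k" "\<tau> (Suc k) \<le> 1" using grid_point[of k] grid_point[of "Suc k"] k by auto
    note g = gain_increment[OF s01(1) grid_step(1) s01(2) chosen_paths_filtration[OF k], unfolded grid_step(2)]
    show "integrable Q (?g k i)" by (rule g(1))
    show "integrable time_path (?h k i)" by (rule g(2))
    show "(\<integral>\<omega>. ?g k i \<omega> \<partial>Q) = 2 ^ n * (\<integral>x. ?h k i x \<partial>time_path)" by (rule g(3))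
  qed
  have e1: "(\<Sum>k<2 ^ n. grid_gain n T J k \<omega>) = (\<Sum>k<2 ^ n. \<Sum>i\<le>r. ?g k i \<omega>)" if "\<omega> \<in> space Q" for \<omega>
    using grid_gain_sum that by (simp add: space_Q)
  have e2: "gauss_gain (T (J x)) (\<Sigma>' x) = (\<Sum>k<2 ^ n. \<Sum>i\<le>r. ?h k i x)" if "x \<in> space time_path" for x
  proof -
    obtain t \<omega> where xt: "x = (t, \<omega>)" by (cases x)
    have x: "x = (t, \<omega>)" "t \<in> {0<..1}" "\<omega> \<in> paths" using that xt by (auto simp: space_time_path)
    have "(\<Sum>i\<le>r. ?h k i x) = indicator {\<tau> k<..\<tau> (Suc k)} t * gauss_gain (T (J x)) (\<Sigma>' x)" if k: "k < 2 ^ n" for k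
    proof -
      have "(\<Sum>i\<le>r. ?h k i x) = indicator {\<tau> k<..\<tau> (Suc k)} t * (\<Sum>i\<le>r. indicator (chosen_paths k i) \<omega> * gauss_gain (T i) (\<Sigma>' x))"
        unfolding x(1) indicator_times sum_distrib_left by (intro sum.cong refl) (simp only: fst_conv snd_conv mult.assoc)
      also have "\<dots> = indicator {\<tau> k<..\<tau> (Suc k)} t * gauss_gain (T (J (\<tau> (Suc k), \<omega>))) (\<Sigma>' x)"
        unfolding sum_chosen_paths[OF x(3)] ..
      also have "\<dots> = indicator {\<tau> k<..\<tau> (Suc k)} t * gauss_gain (T (J x)) (\<Sigma>' x)"
      proof (cases "t \<in> {\<tau> k<..\<tau> (Suc k)}")
        case True
        from chosen_paths_grid(2)[OF k True x(3)] show ?thesis unfolding x(1) by (simp only:)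
      next
        case False
        then show ?thesis by (simp only: indicator_simps(2) mult_zero_left not_False_eq_True)
      qed
      finally show ?thesis .
    qed
    then have "(\<Sum>k<2 ^ n. \<Sum>i\<le>r. ?h k i x) = (\<Sum>k<2 ^ n. indicator {\<tau> k<..\<tau> (Suc k)} t * gauss_gain (T (J x)) (\<Sigma>' x))"
      by (intro sum.cong refl) (simp only: lessThan_iff)
    also have "\<dots> = indicator {0<..\<tau> (2 ^ n)} t * gauss_gain (T (J x)) (\<Sigma>' x)"
      unfolding sum_distrib_right[symmetric] sum_grid_indicator ..
    finally show ?thesis using x(2) by simp
  qed
  have "integrable Q (\<lambda>\<omega>. \<Sum>k<2 ^ n. \<Sum>i\<le>r. ?g k i \<omega>)"
    by (rule integral_double_sum(1)) (use gi(1) in blast)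
  then show "integrable Q (\<lambda>\<omega>. \<Sum>k<2 ^ n. grid_gain n T J k \<omega>)"
    using e1 by (simp cong: Bochner_Integration.integrable_cong)
  have "(\<integral>\<omega>. (\<Sum>k<2 ^ n. grid_gain n T J k \<omega>) \<partial>Q) = (\<integral>\<omega>. (\<Sum>k<2 ^ n. \<Sum>i\<le>r. ?g k i \<omega>) \<partial>Q)"
    by (rule Bochner_Integration.integral_cong[OF refl e1])
  also have "\<dots> = (\<Sum>k<2 ^ n. \<Sum>i\<le>r. \<integral>\<omega>. ?g k i \<omega> \<partial>Q)"
    by (rule integral_double_sum(2)) (use gi(1) in blast)
  also have "\<dots> = (\<Sum>k<2 ^ n. \<Sum>i\<le>r. 2 ^ n * (\<integral>x. ?h k i x \<partial>time_path))"
    using gi(3) by (intro sum.cong refl) auto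
  also have "\<dots> = 2 ^ n * (\<Sum>k<2 ^ n. \<Sum>i\<le>r. \<integral>x. ?h k i x \<partial>time_path)"
    by (simp only: sum_distrib_left)
  also have "(\<Sum>k<2 ^ n. \<Sum>i\<le>r. \<integral>x. ?h k i x \<partial>time_path) = (\<integral>x. (\<Sum>k<2 ^ n. \<Sum>i\<le>r. ?h k i x) \<partial>time_path)"
    by (rule integral_double_sum(2)[symmetric]) (use gi(2) in blast)
  also have "\<dots> = (\<integral>x. gauss_gain (T (J x)) (\<Sigma>' x) \<partial>time_path)"
    by (rule Bochner_Integration.integral_cong[OF refl e2[symmetric]])
  finally show "(\<integral>\<omega>. (\<Sum>k<2 ^ n. grid_gain n T J k \<omega>) \<partial>Q) = 2 ^ n * (\<integral>x. gauss_gain (T (J x)) (\<Sigma>' x) \<partial>time_path)" .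
qed

text \<open>
  The sum of the grid gains is a function of the path on the grid, so it is an admissible test for the
  restricted measures.
\<close>

lemma relative_entropy_grid_ge:
  fixes B :: "(real \<Rightarrow> real ^ 'l) measure"
  assumes B: "is_wiener_measure B"
  shows "ereal (\<integral>x. gauss_gain (T (J x)) (\<Sigma>' x) \<partial>time_path) \<le> ereal (1 / 2 ^ n) *
     relative_entropy (restr_to_subalg Q (grid_sigma (2 ^ n))) (restr_to_subalg B (grid_sigma (2 ^ n)))"
proof -
  define S where "S = {real j / 2 ^ n |j. j \<le> 2 ^ n}"
  define G :: "(real \<Rightarrow> real ^ 'l) measure" where "G = path_sigma S"
  have G: "grid_sigma (2 ^ n) = G" by (simp add: grid_sigma_def G_def S_def)
  have S01: "S \<subseteq> {0..1}" unfolding S_def using grid_point by auto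
  have sQ: "subalgebra Q G" unfolding G_def by (rule subalgebra_path_sigma[OF S01])
  have sB: "subalgebra B G"
  proof -
    have sB: "sets B = sets (path_filtration 1)" using B by (simp add: is_wiener_measure_def is_path_law_def)
    then show ?thesis unfolding subalgebra_def G_def
      using sets_eq_imp_space_eq[OF sB] path_sigma_mono[OF S01] by simp
  qed
  define L where "L \<omega> = (\<Sum>k<2 ^ n. grid_gain n T J k \<omega>)" for \<omega>
  have LG: "L \<in> borel_measurable G"
    unfolding L_def G_def
  proof (intro borel_measurable_sum grid_gain_measurable)
    fix k assume "k \<in> {..<2 ^ n :: nat}"
    then show "k < 2 ^ n" "{real j / 2 ^ n |j. j \<le> Suc k} \<subseteq> S" by (auto simp: S_def)
  qed
  let ?Q = "restr_to_subalg Q G" and ?B = "restr_to_subalg B G"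
  let ?I = "\<integral>x. gauss_gain (T (J x)) (\<Sigma>' x) \<partial>time_path"
  show ?thesis
  proof (cases "absolutely_continuous ?B ?Q \<and> integrable ?Q (entropy_density (exp 1) ?B ?Q)")
    case False
    then show ?thesis by (auto simp: relative_entropy_def G)
  next
    case True
    have "(\<integral>\<omega>. L \<omega> \<partial>?Q) \<le> KL_divergence (exp 1) ?B ?Q"
    proof (rule KL_divergence_ge_integral)
      show "prob_space ?B" using sB B by (intro prob_space_restr_to_subalg) (auto simp: is_wiener_measure_def is_path_law_def)
      show "prob_space ?Q" using sQ by (intro prob_space_restr_to_subalg prob_space_axioms)
      show "sets ?Q = sets ?B" using sQ sB by (simp add: sets_restr_to_subalg)
      show "L \<in> borel_measurable ?B" by (rule measurable_in_subalg[OF sB LG])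
      show "integrable ?Q L"
        unfolding L_def[abs_def] by (intro integrable_in_subalg[OF sQ LG[unfolded L_def[abs_def]]] grid_gain_integral(1))
      have "(\<integral>\<^sup>+\<omega>. ennreal (exp (L \<omega>)) \<partial>?B) = (\<integral>\<^sup>+\<omega>. ennreal (exp (L \<omega>)) \<partial>B)"
        using LG by (intro nn_integral_subalgebra2[OF sB]) auto
      also have "\<dots> = (\<integral>\<^sup>+\<omega>. (\<Prod>k<2 ^ n. ennreal (exp (grid_gain n T J k \<omega>))) \<partial>B)"
        by (simp add: L_def exp_sum prod_ennreal)
      also have "\<dots> = 1" by (rule exp_grid_gain_wiener[OF B]) simp
      finally show "(\<integral>\<^sup>+\<omega>. ennreal (exp (L \<omega>)) \<partial>?B) \<le> 1" by simp
    qed (use True in auto)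
    also have "(\<integral>\<omega>. L \<omega> \<partial>?Q) = (\<integral>\<omega>. L \<omega> \<partial>Q)" by (rule integral_subalgebra2[OF sQ LG])
    also have "\<dots> = 2 ^ n * ?I" using grid_gain_integral(2) by (simp add: L_def)
    finally show ?thesis using True by (simp add: relative_entropy_def G field_simps)
  qed
qed

end

end

section \<open>Refining the grid and optimising the test\<close>

text \<open>
  Breaking ties by the least index makes the selection measurable in \<open>S\<close>.
\<close>

definition best_index :: "(nat \<Rightarrow> real ^ 'n ^ 'n::finite) \<Rightarrow> nat \<Rightarrow> real ^ 'n ^ 'n \<Rightarrow> nat" where
  "best_index T r S = (LEAST i. i \<le> r \<and> (\<forall>j\<le>r. gauss_gain (T j) S \<le> gauss_gain (T i) S))"

lemma best_index: "best_index T r S \<le> r" "j \<le> r \<Longrightarrow> gauss_gain (T j) S \<le> gauss_gain (T (best_index T r S)) S"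
proof -
  let ?g = "\<lambda>i. gauss_gain (T i) S"
  have "Max (?g ` {..r}) \<in> ?g ` {..r}" by (intro Max_in) auto
  then obtain i where i: "Max (?g ` {..r}) = ?g i" "i \<in> {..r}" by (rule imageE)
  have "?g j \<le> ?g i" if "j \<le> r" for j
    unfolding i(1)[symmetric] using that by (intro Max_ge) auto
  then have "i \<le> r \<and> (\<forall>j\<le>r. ?g j \<le> ?g i)" using i(2) by simp
  then have "best_index T r S \<le> r \<and> (\<forall>j\<le>r. ?g j \<le> ?g (best_index T r S))"
    unfolding best_index_def by (rule LeastI)
  then show "best_index T r S \<le> r" "j \<le> r \<Longrightarrow> ?g j \<le> ?g (best_index T r S)" by auto
qed

lemma gauss_gain_identity: "gauss_gain (mat 1) S = 0"
  by (simp add: gauss_gain_def matrix_mul_lid transpose_mat)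

context martingale_with_covariance_density
begin

lemma gain_predictable: "(\<lambda>x. gauss_gain T (\<Sigma>' x)) \<in> borel_measurable predictable_sigma"
  unfolding gauss_gain_def
  by (intro borel_measurable_diff borel_measurable_times borel_measurable_sum borel_measurable_const predictable_density_entry)

lemma best_index_predictable: "(\<lambda>x. best_index T r (\<Sigma>' x)) \<in> measurable predictable_sigma (count_space UNIV)"
proof -
  note [measurable] = gain_predictable
  show ?thesis unfolding best_index_def by measurable
qed

lemmas gain_measurable = predictable_measurable_time_path[OF gain_predictable]
lemmas best_index_measurable = predictable_measurable_time_path[OF best_index_predictable]

lemma integrable_selected_gain:
  fixes J :: "real \<times> (real \<Rightarrow> real ^ 'l) \<Rightarrow> nat"
  assumes "J \<in> measurable time_path (count_space UNIV)" "\<And>x. x \<in> space time_path \<Longrightarrow> J x \<le> r"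
  shows "integrable time_path (\<lambda>x. gauss_gain (T (J x)) (\<Sigma>' x))"
proof (rule Bochner_Integration.integrable_bound)
  show "integrable time_path (\<lambda>x. \<Sum>i\<le>r. \<bar>gauss_gain (T i) (\<Sigma>' x)\<bar>)"
    using integrable_gain_density by (intro Bochner_Integration.integrable_sum integrable_abs)
  show "(\<lambda>x. gauss_gain (T (J x)) (\<Sigma>' x)) \<in> borel_measurable time_path"
    by (rule measurable_compose_countable[where f="\<lambda>i x. gauss_gain (T i) (\<Sigma>' x)", OF gain_measurable assms(1)])
  show "AE x in time_path. norm (gauss_gain (T (J x)) (\<Sigma>' x)) \<le> norm (\<Sum>i\<le>r. \<bar>gauss_gain (T i) (\<Sigma>' x)\<bar>)"
  proof (rule AE_I2)
    fix x assume "x \<in> space time_path"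
    then have "\<bar>gauss_gain (T (J x)) (\<Sigma>' x)\<bar> \<le> (\<Sum>i\<le>r. \<bar>gauss_gain (T i) (\<Sigma>' x)\<bar>)"
      using assms(2) by (intro member_le_sum) auto
    then show "norm (gauss_gain (T (J x)) (\<Sigma>' x)) \<le> norm (\<Sum>i\<le>r. \<bar>gauss_gain (T i) (\<Sigma>' x)\<bar>)"
      unfolding real_norm_def by (rule order_trans[OF _ abs_ge_self])
  qed
qed

text \<open>
  Approximate each event on which index \<open>i\<close> is best by a grid-predictable set, in the measure with
  density \<open>w = \<Sum>\<^bsub>i \<le> r\<^esub> \<bar>gain\<^sub>i\<bar>\<close>.  A wrong choice costs at most \<open>w\<close>, so the total loss is at most the measure
  of the set where one of the approximations is wrong.  By monotonicity of the grids the same sets serve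
  at all finer levels.
\<close>

lemma grid_selection_near_best:
  assumes e: "0 < (e::real)"
  shows "\<exists>n. \<forall>m\<ge>n. \<exists>J \<in> measurable (grid_predictable m) (count_space UNIV). (\<forall>x. J x \<le> r) \<and>
    (\<integral>x. gauss_gain (T (best_index T r (\<Sigma>' x))) (\<Sigma>' x) \<partial>time_path) - e
      \<le> (\<integral>x. gauss_gain (T (J x)) (\<Sigma>' x) \<partial>time_path)"
proof -
  define w where "w x = (\<Sum>i\<le>r. \<bar>gauss_gain (T i) (\<Sigma>' x)\<bar>)" for x
  have wi: "integrable time_path w" unfolding w_def
    using integrable_gain_density by (intro Bochner_Integration.integrable_sum integrable_abs)
  have w0: "0 \<le> w x" for x by (simp add: w_def sum_nonneg)
  have wm[measurable]: "w \<in> borel_measurable time_path" using wi by (rule borel_measurable_integrable)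
  define nu where "nu = density time_path (\<lambda>x. ennreal (w x))"
  have nu_sets: "sets nu = sets time_path" "space nu = space time_path" by (simp_all add: nu_def)
  have nuf: "finite_measure nu"
  proof (rule finite_measureI)
    have "emeasure nu (space nu) = (\<integral>\<^sup>+x. ennreal (w x) \<partial>time_path)"
      unfolding nu_def by (simp add: emeasure_density cong: nn_integral_cong)
    also have "\<dots> = ennreal (\<integral>x. w x \<partial>time_path)"
      using wi w0 by (intro nn_integral_eq_integral) auto
    finally show "emeasure nu (space nu) \<noteq> \<infinity>" by simp
  qed
  interpret nu: finite_measure nu by fact
  define E where "E i = (\<lambda>x. best_index T r (\<Sigma>' x)) -` {i} \<inter> space predictable_sigma \<inter> space time_path" for i
  have E_sig: "E i \<in> sigma_sets (space nu) (\<Union>n. sets (grid_predictable n))" for i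
    unfolding E_def nu_sets space_time_path
    by (intro predictable_generated_by_grid measurable_sets[OF best_index_predictable]) simp
  define d where "d = e / real (Suc r)"
  have d: "0 < d" using e by (simp add: d_def)
  have "\<exists>n. \<exists>A\<in>sets (grid_predictable n). measure nu ((E i - A) \<union> (A - E i)) < d" for i
  proof (rule approx_by_increasing_sigma_algebras[OF nuf _ _ _ E_sig d])
    show "sets (grid_predictable n) \<subseteq> sets nu" for n
      unfolding nu_sets by (rule sets_grid_predictable_time_path)
    show "space (grid_predictable n) = space nu" for n unfolding nu_sets by (simp add: space_time_path)
  qed (rule grid_predictable_mono)
  then obtain k A where A: "\<And>i. A i \<in> sets (grid_predictable (k i))"
    "\<And>i. measure nu ((E i - A i) \<union> (A i - E i)) < d" by metis
  define n where "n = Max (k ` {..r})"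
  show ?thesis
  proof (intro exI[of _ n] allI impI)
    fix m assume m: "n \<le> m"
    have Am: "A i \<in> sets (grid_predictable m)" if "i \<le> r" for i
    proof -
      have "k i \<le> m" using that m by (auto simp: n_def intro: order_trans[OF Max_ge])
      then show ?thesis using A(1)[of i] grid_predictable_mono by blast
    qed
    \<comment> \<open>The approximating sets need neither be disjoint nor cover; the alternative \<open>r \<le> i\<close> makes the choice well defined and at most \<open>r\<close>.\<close>
    define J where "J x = (LEAST i. r \<le> i \<or> x \<in> A i)" for x
    have Jr: "J x \<le> r" for x unfolding J_def by (rule Least_le) simp
    have Jm: "J \<in> measurable (grid_predictable m) (count_space UNIV)"
      unfolding J_def
    proof (rule measurable_Least)
      show "Measurable.pred (grid_predictable m) (\<lambda>x. r \<le> i \<or> x \<in> A i)" for i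
        unfolding pred_def
      proof (cases "r \<le> i")
        case True
        then have "{x \<in> space (grid_predictable m). r \<le> i \<or> x \<in> A i} = space (grid_predictable m)" by auto
        then show "{x \<in> space (grid_predictable m). r \<le> i \<or> x \<in> A i} \<in> sets (grid_predictable m)"
          by (simp only: sets.top)
      next
        case False
        then have "{x \<in> space (grid_predictable m). r \<le> i \<or> x \<in> A i} = A i"
          using sets.sets_into_space[OF Am[of i]] by auto
        then show "{x \<in> space (grid_predictable m). r \<le> i \<or> x \<in> A i} \<in> sets (grid_predictable m)"
          using Am False by simp
      qed
    qed
    have Jt: "J \<in> measurable time_path (count_space UNIV)"
      using Jm sets_grid_predictable_time_path[of m] by (auto simp: measurable_def space_time_path)
    define bad where "bad = (\<Union>i\<le>r. (E i - A i) \<union> (A i - E i))"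
    have Esets: "E i \<in> sets time_path" for i
      unfolding E_def by (intro sets_predictable_time_path measurable_sets[OF best_index_predictable]) simp
    have Asets: "A i \<in> sets time_path" for i using A(1) sets_grid_predictable_time_path by blast
    have badm: "bad \<in> sets time_path" unfolding bad_def using Esets Asets by auto
    have Jgood: "J x = best_index T r (\<Sigma>' x)" if x: "x \<in> space time_path" "x \<notin> bad" for x
    proof -
      let ?b = "best_index T r (\<Sigma>' x)"
      have xs: "x \<in> space predictable_sigma" using x(1) by (auto simp: space_time_path space_predictable_sigma)
      have iff: "x \<in> A i \<longleftrightarrow> ?b = i" if "i \<le> r" for i
      proof -
        have "x \<notin> (E i - A i) \<union> (A i - E i)" using x(2) that unfolding bad_def by blast
        moreover have "x \<in> E i \<longleftrightarrow> ?b = i" unfolding E_def using x(1) xs by blast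
        ultimately show ?thesis by blast
      qed
      have br: "?b \<le> r" by (rule best_index(1))
      show ?thesis unfolding J_def
      proof (rule Least_equality)
        show "r \<le> ?b \<or> x \<in> A ?b" using iff[OF br] by simp
        show "?b \<le> i" if "r \<le> i \<or> x \<in> A i" for i
          using that iff[of i] br by (cases "r \<le> i") auto
      qed
    qed
    have int1: "integrable time_path (\<lambda>x. gauss_gain (T (best_index T r (\<Sigma>' x))) (\<Sigma>' x))"
      by (rule integrable_selected_gain[OF best_index_measurable best_index(1)])
    have int2: "integrable time_path (\<lambda>x. gauss_gain (T (J x)) (\<Sigma>' x))"
      by (rule integrable_selected_gain[OF Jt Jr])
    have int3: "integrable time_path (\<lambda>x. indicator bad x * w x)"
      using integrable_mult_indicator[OF badm wi] by simp
    have "(\<integral>x. gauss_gain (T (best_index T r (\<Sigma>' x))) (\<Sigma>' x) \<partial>time_path) - (\<integral>x. gauss_gain (T (J x)) (\<Sigma>' x) \<partial>time_path)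
      = (\<integral>x. gauss_gain (T (best_index T r (\<Sigma>' x))) (\<Sigma>' x) - gauss_gain (T (J x)) (\<Sigma>' x) \<partial>time_path)"
      by (rule Bochner_Integration.integral_diff[OF int1 int2, symmetric])
    also have "\<dots> \<le> (\<integral>x. indicator bad x * w x \<partial>time_path)"
    proof (rule integral_mono[OF Bochner_Integration.integrable_diff[OF int1 int2] int3])
      fix x assume x: "x \<in> space time_path"
      let ?b = "best_index T r (\<Sigma>' x)" and ?f = "\<lambda>i. gauss_gain (T i) (\<Sigma>' x)"
      show "?f ?b - ?f (J x) \<le> indicator bad x * w x"
      proof (cases "x \<in> bad \<and> J x \<noteq> ?b")
        case True
        have "\<bar>?f ?b\<bar> + \<bar>?f (J x)\<bar> = (\<Sum>i\<in>{?b, J x}. \<bar>?f i\<bar>)" using True by auto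
        also have "\<dots> \<le> w x" unfolding w_def
          using best_index(1)[of T r "\<Sigma>' x"] Jr[of x] by (intro sum_mono2) auto
        finally show ?thesis using True by simp
      next
        case False
        then have "J x = ?b" using Jgood[OF x] by auto
        then show ?thesis using w0 by simp
      qed
    qed
    also have "\<dots> = measure nu bad"
    proof -
      have "emeasure nu bad = (\<integral>\<^sup>+x. ennreal (indicator bad x * w x) \<partial>time_path)"
        unfolding nu_def using badm
        by (subst emeasure_density) (auto intro!: nn_integral_cong simp: indicator_def)
      also have "\<dots> = ennreal (\<integral>x. indicator bad x * w x \<partial>time_path)"
        using int3 w0 by (intro nn_integral_eq_integral) auto
      finally show ?thesis using w0 by (simp add: measure_def)
    qed
    also have "\<dots> \<le> (\<Sum>i\<le>r. measure nu ((E i - A i) \<union> (A i - E i)))"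
      unfolding bad_def using Esets Asets
      by (intro nu.finite_measure_subadditive_finite) (auto simp: nu_sets)
    also have "\<dots> \<le> (\<Sum>i\<le>r. d)" using A(2) by (intro sum_mono less_imp_le)
    also have "\<dots> = e" by (simp add: d_def)
    finally show "\<exists>J \<in> measurable (grid_predictable m) (count_space UNIV). (\<forall>x. J x \<le> r) \<and>
      (\<integral>x. gauss_gain (T (best_index T r (\<Sigma>' x))) (\<Sigma>' x) \<partial>time_path) - e
        \<le> (\<integral>x. gauss_gain (T (J x)) (\<Sigma>' x) \<partial>time_path)"
      using Jm Jr by (intro bexI[of _ J]) auto
  qed
qed

lemma specific_relative_entropy_ge_best_gain:
  fixes B :: "(real \<Rightarrow> real ^ 'l) measure"
  assumes B: "is_wiener_measure B" and T: "\<And>i. det (T i) \<noteq> 0"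
  shows "ereal (\<integral>x. gauss_gain (T (best_index T r (\<Sigma>' x))) (\<Sigma>' x) \<partial>time_path) \<le> specific_relative_entropy Q B"
proof (rule ereal_le_epsilon2)
  fix e :: real assume "0 < e"
  let ?I = "\<integral>x. gauss_gain (T (best_index T r (\<Sigma>' x))) (\<Sigma>' x) \<partial>time_path"
  obtain n where n: "\<And>m. n \<le> m \<Longrightarrow> \<exists>J \<in> measurable (grid_predictable m) (count_space UNIV). (\<forall>x. J x \<le> r) \<and>
      ?I - e \<le> (\<integral>x. gauss_gain (T (J x)) (\<Sigma>' x) \<partial>time_path)"
    using grid_selection_near_best[OF \<open>0 < e\<close>] by blast
  have "ereal (?I - e) \<le> ereal (1 / 2 ^ m) *
      relative_entropy (restr_to_subalg Q (grid_sigma (2 ^ m))) (restr_to_subalg B (grid_sigma (2 ^ m)))"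
    if m: "n \<le> m" for m
  proof -
    obtain J where J: "J \<in> measurable (grid_predictable m) (count_space UNIV)" "\<And>x. J x \<le> r"
      "?I - e \<le> (\<integral>x. gauss_gain (T (J x)) (\<Sigma>' x) \<partial>time_path)" using n[OF m] by blast
    have "ereal (?I - e) \<le> ereal (\<integral>x. gauss_gain (T (J x)) (\<Sigma>' x) \<partial>time_path)" using J(3) by simp
    also note relative_entropy_grid_ge[OF J(1,2) T B]
    finally show ?thesis .
  qed
  then have "ereal (?I - e) \<le> specific_relative_entropy Q B"
    unfolding specific_relative_entropy_def
    by (intro Liminf_bounded) (auto simp: eventually_sequentially)
  then show "ereal ?I \<le> specific_relative_entropy Q B + ereal e"
    by (cases "specific_relative_entropy Q B") auto
qed

lemma entropy_lower_bound:
  fixes B :: "(real \<Rightarrow> real ^ 'l) measure"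
  assumes B: "is_wiener_measure B"
  shows "enn2ereal (\<integral>\<^sup>+\<omega>. (\<integral>\<^sup>+t\<in>{0..1}. e2ennreal (F_fun (\<Sigma> t \<omega>)) \<partial>lborel) \<partial>Q) \<le> specific_relative_entropy Q B"
proof -
  obtain T :: "nat \<Rightarrow> real ^ 'l ^ 'l" where T0: "T 0 = mat 1" and T: "\<And>i. det (T i) \<noteq> 0"
    and F: "\<And>S. pos_semidef S \<Longrightarrow> e2ennreal (F_fun S) \<le> (SUP i. ennreal (gauss_gain (T i) S))"
    using F_fun_le_SUP_gauss_gain by blast
  define b where "b r x = gauss_gain (T (best_index T r (\<Sigma>' x))) (\<Sigma>' x)" for r x
  have b0: "0 \<le> b r x" for r x
    using best_index(2)[of 0 r T "\<Sigma>' x"] by (simp add: b_def T0 gauss_gain_identity)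
  have bint: "integrable time_path (b r)" for r
    unfolding b_def by (rule integrable_selected_gain[OF best_index_measurable best_index(1)])
  have bm[measurable]: "b r \<in> borel_measurable time_path" for r using bint by (rule borel_measurable_integrable)
  have bmono: "b r x \<le> b r' x" if "r \<le> r'" for r r' x
    unfolding b_def using best_index(1)[of T r "\<Sigma>' x"] that by (intro best_index(2)) auto
  have Fb: "e2ennreal (F_fun (\<Sigma> t \<omega>)) \<le> (SUP r. ennreal (b r (t, \<omega>)))" if "t \<in> {0..1}" "\<omega> \<in> paths" for t \<omega>
  proof -
    have "ennreal (gauss_gain (T i) (\<Sigma> t \<omega>)) \<le> ennreal (b i (t, \<omega>))" for i
      using best_index(2)[of i i T "\<Sigma> t \<omega>"] by (simp add: b_def ennreal_leI)
    then have "(SUP i. ennreal (gauss_gain (T i) (\<Sigma> t \<omega>))) \<le> (SUP r. ennreal (b r (t, \<omega>)))"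
      by (intro SUP_mono) auto
    with F[OF psd[OF that]] show ?thesis by (rule order_trans)
  qed
  have "(\<integral>\<^sup>+\<omega>. (\<integral>\<^sup>+t\<in>{0..1}. e2ennreal (F_fun (\<Sigma> t \<omega>)) \<partial>lborel) \<partial>Q)
    \<le> (\<integral>\<^sup>+\<omega>. (\<integral>\<^sup>+t. (SUP r. ennreal (b r (t, \<omega>))) \<partial>unit_time) \<partial>Q)"
  proof (rule nn_integral_mono)
    fix \<omega> assume "\<omega> \<in> space Q"
    then have w: "\<omega> \<in> paths" by (simp add: space_Q)
    have "(\<integral>\<^sup>+t\<in>{0..1}. e2ennreal (F_fun (\<Sigma> t \<omega>)) \<partial>lborel) \<le> (\<integral>\<^sup>+t. (SUP r. ennreal (b r (t, \<omega>))) * indicator {0<..1} t \<partial>lborel)"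
      \<comment> \<open>The time \<open>0\<close>, absent from the product space, is null.\<close>
      using AE_lborel_singleton[of "0::real"]
      by (intro nn_integral_mono_AE, eventually_elim) (use Fb[OF _ w] in \<open>auto simp: indicator_def\<close>)
    then show "(\<integral>\<^sup>+t\<in>{0..1}. e2ennreal (F_fun (\<Sigma> t \<omega>)) \<partial>lborel) \<le> (\<integral>\<^sup>+t. (SUP r. ennreal (b r (t, \<omega>))) \<partial>unit_time)"
      by (subst nn_integral_restrict_space) auto
  qed
  also have "\<dots> = (\<integral>\<^sup>+x. (SUP r. ennreal (b r x)) \<partial>time_path)"
    by (subst time_path.nn_integral_snd) auto
  also have "\<dots> = (SUP r. \<integral>\<^sup>+x. ennreal (b r x) \<partial>time_path)"
    using bmono by (intro nn_integral_monotone_convergence_SUP) (auto simp: incseq_def le_fun_def ennreal_leI)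
  also have "\<dots> \<le> e2ennreal (specific_relative_entropy Q B)"
  proof (rule SUP_least)
    fix r
    have "(\<integral>\<^sup>+x. ennreal (b r x) \<partial>time_path) = e2ennreal (ereal (\<integral>x. b r x \<partial>time_path))"
      using bint b0 by (subst nn_integral_eq_integral) (auto simp: e2ennreal_ereal)
    also have "\<dots> \<le> e2ennreal (specific_relative_entropy Q B)"
      unfolding b_def by (intro e2ennreal_mono specific_relative_entropy_ge_best_gain B T)
    finally show "(\<integral>\<^sup>+x. ennreal (b r x) \<partial>time_path) \<le> e2ennreal (specific_relative_entropy Q B)" .
  qed
  finally have "enn2ereal (\<integral>\<^sup>+\<omega>. (\<integral>\<^sup>+t\<in>{0..1}. e2ennreal (F_fun (\<Sigma> t \<omega>)) \<partial>lborel) \<partial>Q)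
    \<le> enn2ereal (e2ennreal (specific_relative_entropy Q B))"
    by (simp only: less_eq_ennreal.rep_eq)
  moreover have "0 \<le> specific_relative_entropy Q B"
  proof -
    have "0 \<le> ereal (\<integral>x. b 0 x \<partial>time_path)" using b0 by simp
    also have "\<dots> \<le> specific_relative_entropy Q B"
      unfolding b_def by (intro specific_relative_entropy_ge_best_gain B T)
    finally show ?thesis .
  qed
  ultimately show ?thesis by (simp add: enn2ereal_e2ennreal)
qed

end

theorem theorem1p1:
  fixes Q B :: "(real \<Rightarrow> real ^ 'l::finite) measure"
    and V \<Sigma> :: "real \<Rightarrow> (real \<Rightarrow> real ^ 'l) \<Rightarrow> real ^ 'l ^ 'l"
  assumes "is_path_law Q"
    and "canonical_square_integrable_martingale Q"
    and "AE \<omega> in Q. \<omega> 0 = 0"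
    and "\<And>i j. is_quadratic_covariation Q i j (\<lambda>t \<omega>. V t \<omega> $ i $ j)"
    and "(\<lambda>(t, \<omega>). \<Sigma> t \<omega>) \<in> borel_measurable predictable_sigma"
    and "\<And>t \<omega>. t \<in> {0..1} \<Longrightarrow> \<omega> \<in> paths \<Longrightarrow> pos_semidef (\<Sigma> t \<omega>)"
    and "AE \<omega> in Q. set_integrable lborel {0..1} (\<lambda>s. \<Sigma> s \<omega>) \<and>
           (\<forall>t\<in>{0..1}. V t \<omega> = (LINT s:{0..t}|lborel. \<Sigma> s \<omega>))"
    and "is_wiener_measure B"
  shows "specific_relative_entropy Q B \<ge>
    enn2ereal (\<integral>\<^sup>+\<omega>. (\<integral>\<^sup>+t\<in>{0..1}. e2ennreal (F_fun (\<Sigma> t \<omega>)) \<partial>lborel) \<partial>Q)"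
proof -
  interpret martingale_with_covariance_density Q V \<Sigma>
    using assms(1,2,4,5,6,7) by (rule martingale_with_covariance_density.intro)
  show ?thesis using assms(8) by (rule entropy_lower_bound)
qed

end
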